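(* (Plancherel formula II) For any $f,g\in\mathcal P$, $$t^{-1/2}\,\langle\!\langle \mathbf S(f),\,T\,\mathbf S(g)\rangle\!\rangle_1=\langle\!\langle f,g\rangle\!\rangle_0,\qquad t^{-1/2}\,\langle\!\langle \mathbf E(f),\,T\,\mathbf E(g)\rangle\!\rangle_1=\overline{\langle\!\langle f,g\rangle\!\rangle_0}.$$
   Context: Let $q^{1/2},t^{1/2}$ be formal parameters, $t=q^k$, $\mathbb K=\mathbb C(q^{1/2},t^{1/2})$, $X=q^x$, $\mathcal P=\mathbb K[X^{\pm1}]$. The bar is the $\mathbb C$-linear ring involution $\bar X=X^{-1}$, $\overline{q^{1/2}}=q^{-1/2}$, $\overline{t^{1/2}}=t^{-1/2}$. The constant term of a Laurent series in $X$ is denoted $\langle\cdot\rangle$. Put $$\mu_k(x)=\prod_{j\ge0}\frac{(1-q^{j}X^2)(1-q^{j+1}X^{-2})}{(1-tq^{j}X^2)(1-tq^{j+1}X^{-2})},\qquad \mu_k^0=\mu_k/\langle\mu_k\rangle,$$ ($\mu_k$ is expanded in powers of $q,t$; the coefficients of the Laurent series $\mu_k^0$ are in $\mathbb Q(q,t)$). For $n\in\mathbb Z$ put $n_\#=(n+\mathrm{sgn}(n)k)/2$ with $\mathrm{sgn}(0)=-1$, so $0_\#=-k/2$; the value of a Laurent polynomial at $n_\#$ is its value at $X=q^{n_\#}=q^{n/2}t^{\mathrm{sgn}(n)/2}$. Order monomials by: $X^m\prec X^n$ if $|m|<|n|$ or $m=-n>0$. The nonsymmetric polynomial $e_n\in\mathcal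 P$ is determined by $e_n=X^n+(\text{terms lower with respect to }\prec)$ and $\langle e_n X^{-m}\mu_k^0\rangle=0$ whenever $X^m\prec X^n$; $\varepsilon_n=e_n/e_n(-k/2)$. Let $\mathbb Z_\#=\{n_\#: n\in\mathbb Z\}$ and let $\mathcal F$ be the space of finitely supported $\mathbb K$-valued functions on $\mathbb Z_\#$. The operator $T$ on $\mathcal F$ is $$(Tf)(n_\#)=\frac{t^{1/2}q^{2n_\#}-t^{-1/2}}{q^{2n_\#}-1}f(-n_\#)-\frac{t^{1/2}-t^{-1/2}}{q^{2n_\#}-1}f(n_\#)$$ (the first term is zero for $n=0$). The transforms $\mathbf S,\mathbf E:\mathcal P\to\mathcal F$ are $$\mathbf S(f)(n_\#)=\langle f\,\varepsilon_n\,\mu_k^0\rangle,\qquad \mathbf E(f)(n_\#)=\langle \bar f\,\varepsilon_n\,\mu_k^0\rangle .$$ The scalar products (without conjugation) are $\langle\!\langle f,g\rangle\!\rangle_0=\langle fg\mu_k^0\rangle$ on $\mathcal P$ and $\langle\!\langle f,g\rangle\!\rangle_1=\sum_{n\in\mathbb Z}f(n_\#)g(n_\#)\mu_k^1(n_\#)$ on $\mathcal F$, where for $n>0$ $$\mu_k^1(n_\#)=\mu_k^1((1-n)_\#)=t^{-(n-1)}\prod_{j=1}^{n-1}\frac{1-t^2q^j}{1-q^j}.$$ *)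

theory Defs
  imports
    "HOL-Analysis.Infinite_Products"
    "HOL-Library.Poly_Mapping"
    "HOL-Computational_Algebra.Fraction_Field"
    "HOL-Computational_Algebra.Polynomial_FPS"
begin

section \<open>The field of coefficients and its bar involution\<close>

text \<open>
  \<open>K\<close> is the field of rational functions over the complex numbers in two independent
  variables: \<open>q\<^sup>1\<^sup>/\<^sup>2\<close> (\<open>qh\<close>) is the variable of the outer polynomials and
  \<open>t\<^sup>1\<^sup>/\<^sup>2\<close> (\<open>th\<close>) that of the inner ones. As \<open>t = q\<^sup>k\<close> is itself a formal parameter, \<open>k\<close> occurs
  only through \<open>t\<close>.
\<close>

type_synonym K = "complex poly poly fract"

definition K_const :: "complex \<Rightarrow> K" where
  "K_const c = Fract [:[:c:]:] 1"

definition qh :: K where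
  "qh = Fract [:0, 1:] 1"

definition th :: K where
  "th = Fract [:[:0, 1:]:] 1"

definition subst_inv :: "complex poly poly \<Rightarrow> K" where
  "subst_inv p =
     poly (map_poly (\<lambda>r. poly (map_poly K_const r) (inverse th)) p) (inverse qh)"

definition K_bar :: "K \<Rightarrow> K" where
  "K_bar x = (THE y. \<exists>a b. b \<noteq> 0 \<and> x = Fract a b \<and> y = subst_inv a / subst_inv b)"

text \<open>
  \<open>K_bar\<close> is well defined, and is a \<open>\<complex>\<close>-linear ring endomorphism inverting both variables.
\<close>

lemma K_const_simps [simp]:
  "K_const 0 = 0" "K_const 1 = 1"
  "K_const (a + b) = K_const a + K_const b" "K_const (a * b) = K_const a * K_const b"
  by (simp_all add: K_const_def Zero_fract_def One_fract_def one_pCons)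

lemma qh_nonzero [simp]: "qh \<noteq> 0" and th_nonzero [simp]: "th \<noteq> 0"
  by (simp_all add: qh_def th_def Zero_fract_def eq_fract)

lemma map_poly_hom_mult:
  fixes f :: "'a::comm_ring_1 \<Rightarrow> 'b::comm_ring_1"
  assumes "f 0 = 0" "\<And>a b. f (a + b) = f a + f b" "\<And>a b. f (a * b) = f a * f b"
  shows "map_poly f (p * r) = map_poly f p * map_poly f r"
proof -
  have s: "f (sum g A) = (\<Sum>x\<in>A. f (g x))" if "finite A" for g and A :: "nat set"
    using that by (induction A rule: finite_induct) (auto simp: assms)
  show ?thesis
    by (rule poly_eqI) (simp add: coeff_map_poly coeff_mult assms s)
qed

lemma map_poly_hom_add:
  fixes f :: "'a::comm_ring_1 \<Rightarrow> 'b::comm_ring_1"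
  assumes "f 0 = 0" "\<And>a b. f (a + b) = f a + f b"
  shows "map_poly f (p + r) = map_poly f p + map_poly f r"
  by (rule poly_eqI) (simp add: coeff_map_poly assms)

lemma subst_inv_add: "subst_inv (a + b) = subst_inv a + subst_inv b"
  unfolding subst_inv_def by (subst map_poly_hom_add) (auto simp: map_poly_hom_add)

lemma subst_inv_mult: "subst_inv (a * b) = subst_inv a * subst_inv b"
  unfolding subst_inv_def
  by (subst map_poly_hom_mult) (auto simp: map_poly_hom_add map_poly_hom_mult)

lemma subst_inv_1 [simp]: "subst_inv 1 = 1"
  by (simp add: subst_inv_def map_poly_1')

lemma poly_altdef_le:
  fixes p :: "'a::comm_ring_1 poly"
  assumes "degree p \<le> n"
  shows "poly p x = (\<Sum>i\<le>n. coeff p i * x ^ i)"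
  unfolding poly_altdef
  by (rule sum.mono_neutral_left) (use assms in \<open>auto simp: coeff_eq_0\<close>)

lemma Fract_1_sum: "(\<Sum>x\<in>A. Fract (f x) 1) = Fract (sum f A) 1" if "finite A" for f :: "nat \<Rightarrow> 'a::idom"
  using that by (induction A rule: finite_induct) (auto simp: Zero_fract_def)

lemma th_power: "th ^ n = Fract [:monom 1 n:] 1"
proof (induction n)
  case 0
  have "[:monom 1 0:] = (1 :: complex poly poly)" by (simp add: one_pCons monom_0)
  then show ?case by (simp only: One_fract_def power_0)
qed (simp add: th_def monom_altdef)

lemma qh_power: "qh ^ n = Fract (monom 1 n) 1"
proof (induction n)
  case 0
  have "monom 1 0 = (1 :: complex poly poly)" by (simp add: one_pCons monom_0)
  then show ?case by (simp only: One_fract_def power_0)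
qed (simp add: qh_def monom_altdef)

lemma subst_inv_eq_0_imp:
  assumes "subst_inv p = 0"
  shows "p = 0"
proof -
  define d where "d = degree p"
  define e where "e = Max (insert 0 ((\<lambda>i. degree (coeff p i)) ` {..d}))"
  define R where "R = (\<lambda>i. \<Sum>j\<le>e. monom (coeff (coeff p i) j) (e - j))"
  have dege: "degree (coeff p i) \<le> e" if "i \<le> d" for i
    unfolding e_def using that by (intro Max_ge) auto
  have inner: "poly (map_poly K_const (coeff p i)) (inverse th) * th ^ e = Fract [:R i:] 1"
    if i: "i \<le> d" for i
  proof -
    have "poly (map_poly K_const (coeff p i)) (inverse th) * th ^ e
        = (\<Sum>j\<le>e. K_const (coeff (coeff p i) j) * inverse th ^ j) * th ^ e"
      by (subst poly_altdef_le[where n = e])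
         (use dege[OF i] in \<open>auto simp: coeff_map_poly coeff_eq_0 intro!: degree_le\<close>)
    also have "\<dots> = (\<Sum>j\<le>e. K_const (coeff (coeff p i) j) * th ^ (e - j))"
      unfolding sum_distrib_right
      by (rule sum.cong) (auto simp: power_diff field_simps)
    also have "\<dots> = (\<Sum>j\<le>e. Fract [:monom (coeff (coeff p i) j) (e - j):] 1)"
      by (rule sum.cong) (auto simp: th_power K_const_def smult_monom)
    also have "\<dots> = Fract (\<Sum>j\<le>e. [:monom (coeff (coeff p i) j) (e - j):]) 1"
      by (rule Fract_1_sum) simp
    also have "(\<Sum>j\<le>e. [:monom (coeff (coeff p i) j) (e - j):]) = [:R i:]"
      unfolding R_def by (rule poly_eqI) (simp add: coeff_sum coeff_pCons split: nat.splits)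
    finally show ?thesis .
  qed
  have "0 = subst_inv p * th ^ e * qh ^ d"
    using assms by simp
  also have "\<dots> = (\<Sum>i\<le>d. poly (map_poly K_const (coeff p i)) (inverse th) * inverse qh ^ i)
                   * th ^ e * qh ^ d"
    unfolding subst_inv_def
    by (subst poly_altdef_le[where n = d])
       (auto simp: coeff_map_poly d_def coeff_eq_0 intro!: degree_le)
  also have "\<dots> = (\<Sum>i\<le>d. (poly (map_poly K_const (coeff p i)) (inverse th) * th ^ e) * qh ^ (d - i))"
    unfolding sum_distrib_right
    by (rule sum.cong) (auto simp: power_diff field_simps)
  also have "\<dots> = (\<Sum>i\<le>d. Fract (monom (R i) (d - i)) 1)"
    by (rule sum.cong) (auto simp: inner qh_power smult_monom)
  also have "\<dots> = Fract (\<Sum>i\<le>d. monom (R i) (d - i)) 1"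
    by (rule Fract_1_sum) simp
  finally have z: "(\<Sum>i\<le>d. monom (R i) (d - i)) = 0"
    by (simp add: Zero_fract_def eq_fract)
  have refl: "coeff (\<Sum>i\<le>n. monom (g i) (n - i)) (n - i) = g i" if "i \<le> n"
    for g :: "nat \<Rightarrow> 'a::comm_ring_1" and n i
  proof -
    have "coeff (\<Sum>i\<le>n. monom (g i) (n - i)) (n - i) = (\<Sum>k\<le>n. if k = i then g k else 0)"
      unfolding coeff_sum by (rule sum.cong) (use that in auto)
    then show ?thesis using that by simp
  qed
  have R0: "R i = 0" if "i \<le> d" for i
    using refl[OF that, of R] z by simp
  have "coeff (coeff p i) j = 0" if "i \<le> d" for i j
  proof (cases "j \<le> e")
    case True
    then show ?thesis
      using refl[OF True, of "coeff (coeff p i)"] R0[OF that] by (simp add: R_def)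
  next
    case False
    then show ?thesis using dege[OF that] by (simp add: coeff_eq_0)
  qed
  then have "coeff p d = 0" by (intro poly_eqI) simp
  then show ?thesis by (simp add: d_def)
qed

lemma K_bar_Fract:
  assumes "b \<noteq> 0"
  shows "K_bar (Fract a b) = subst_inv a / subst_inv b"
  unfolding K_bar_def
proof (rule the_equality)
  fix y assume "\<exists>a' b'. b' \<noteq> 0 \<and> Fract a b = Fract a' b' \<and> y = subst_inv a' / subst_inv b'"
  then obtain a' b' where *: "b' \<noteq> 0" "a * b' = a' * b" "y = subst_inv a' / subst_inv b'"
    using assms by (auto simp: eq_fract)
  have "subst_inv a * subst_inv b' = subst_inv a' * subst_inv b"
    using *(2) by (metis subst_inv_mult)
  then show "y = subst_inv a / subst_inv b"
    using * assms subst_inv_eq_0_imp[of b] subst_inv_eq_0_imp[of b']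
    by (metis frac_eq_eq)
qed (use assms in blast)

lemma K_bar_hom:
  "K_bar (x + y) = K_bar x + K_bar y"
  "K_bar (x * y) = K_bar x * K_bar y"
  "K_bar (K_const c) = K_const c"
  "K_bar qh = inverse qh"
  "K_bar th = inverse th"
proof -
  obtain a b where x: "x = Fract a b" "b \<noteq> 0" by (cases x) auto
  obtain c d where y: "y = Fract c d" "d \<noteq> 0" by (cases y) auto
  have nz: "subst_inv b \<noteq> 0" "subst_inv d \<noteq> 0"
    using x y subst_inv_eq_0_imp by blast+
  show "K_bar (x + y) = K_bar x + K_bar y"
    using x y nz by (simp add: K_bar_Fract subst_inv_add subst_inv_mult field_simps)
  show "K_bar (x * y) = K_bar x * K_bar y"
    using x y nz by (simp add: K_bar_Fract subst_inv_mult)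
  show "K_bar (K_const c) = K_const c" for c
    by (subst K_const_def) (simp add: K_bar_Fract subst_inv_def map_poly_pCons)
  show "K_bar qh = inverse qh"
    by (subst qh_def) (simp add: K_bar_Fract subst_inv_def map_poly_pCons)
  show "K_bar th = inverse th"
    by (subst th_def) (simp add: K_bar_Fract subst_inv_def map_poly_pCons)
qed

section \<open>Laurent polynomials\<close>

text \<open>
  \<open>int \<Rightarrow>\<^sub>0 R\<close> with its convolution product is the ring of Laurent polynomials over \<open>R\<close>;
  the monomial \<open>X\<^sup>m\<close> is \<open>Poly_Mapping.single m 1\<close>.
\<close>

type_synonym laurent = "int \<Rightarrow>\<^sub>0 K"

abbreviation X_pow :: "int \<Rightarrow> int \<Rightarrow>\<^sub>0 'a::zero_neq_one" where
  "X_pow m \<equiv> Poly_Mapping.single m 1"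

definition L_eval :: "laurent \<Rightarrow> K \<Rightarrow> K" where
  "L_eval f x = (\<Sum>m\<in>Poly_Mapping.keys f. Poly_Mapping.lookup f m * x powi m)"

definition L_bar :: "laurent \<Rightarrow> laurent" where
  "L_bar f =
     (\<Sum>m\<in>Poly_Mapping.keys f. Poly_Mapping.single (- m) (K_bar (Poly_Mapping.lookup f m)))"

section \<open>The weight function\<close>

text \<open>
  The expansion of \<open>\<mu>\<^sub>k\<close> in powers of \<open>q\<close> and \<open>t\<close> lives in \<open>\<complex>[X\<^sup>\<plusminus>\<^sup>1][[t\<^sup>1\<^sup>/\<^sup>2]][[q\<^sup>1\<^sup>/\<^sup>2]]\<close>;
  half-integral powers are allowed only so that the variables are those of \<open>K\<close>. The infinite product
  is taken in the \<open>q\<^sup>1\<^sup>/\<^sup>2\<close>-adic metric of the outer power series ring.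
\<close>

type_synonym series = "(int \<Rightarrow>\<^sub>0 complex) fps fps"

definition q_ser :: series where
  "q_ser = fps_X ^ 2"

definition t_ser :: series where
  "t_ser = fps_const (fps_X ^ 2)"

definition X_ser :: "int \<Rightarrow> series" where
  "X_ser m = fps_const (fps_const (X_pow m))"

definition recip_ser :: "series \<Rightarrow> series" where
  "recip_ser u = (THE v. u * v = 1)"

definition mu_factor :: "nat \<Rightarrow> series" where
  "mu_factor j =
     (1 - q_ser ^ j * X_ser 2) * (1 - q_ser ^ (j + 1) * X_ser (-2)) *
     recip_ser ((1 - t_ser * q_ser ^ j * X_ser 2) * (1 - t_ser * q_ser ^ (j + 1) * X_ser (-2)))"

definition mu :: series where
  "mu = prodinf mu_factor"

text \<open>
  The denominators have reciprocals and the infinite product converges, so neither definition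
  falls back on an unspecified value.
\<close>

lemma recip_ser:
  assumes "fps_nth (fps_nth u 0) 0 = 1"
  shows "u * recip_ser u = 1"
proof -
  have "fps_nth u 0 * fps_right_inverse (fps_nth u 0) 1 = 1"
    by (rule fps_right_inverse) (simp add: assms)
  then have "u * fps_right_inverse u (fps_right_inverse (fps_nth u 0) 1) = 1"
    by (rule fps_right_inverse)
  then obtain w where w: "u * w = 1" ..
  have "v = w" if "u * v = 1" for v
  proof -
    have "v = (u * w) * v" by (simp add: w)
    also have "\<dots> = (u * v) * w" by (simp only: mult_ac)
    finally show "v = w" by (simp add: that)
  qed
  with w have "\<exists>!v. u * v = 1" by blast
  then show ?thesis
    unfolding recip_ser_def by (rule theI')
qed

lemma mu_denominator_recip:
  fixes j :: nat
  defines "d \<equiv> (1 - t_ser * q_ser ^ j * X_ser 2) * (1 - t_ser * q_ser ^ (j + 1) * X_ser (-2))"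
  shows "d * recip_ser d = 1"
  by (rule recip_ser)
     (simp add: d_def t_ser_def q_ser_def X_ser_def fps_mult_nth_0 fps_nth_power_0 mult.assoc)

lemma mu_factor_0_nth_0: "fps_nth (mu_factor 0) 0 \<noteq> 0"
proof
  assume "fps_nth (mu_factor 0) 0 = 0"
  moreover have "mu_factor 0 *
      ((1 - t_ser * q_ser ^ 0 * X_ser 2) * (1 - t_ser * q_ser ^ (0 + 1) * X_ser (-2))) =
      (1 - q_ser ^ 0 * X_ser 2) * (1 - q_ser ^ (0 + 1) * X_ser (-2))"
    unfolding mu_factor_def mult.assoc[of _ "recip_ser _"] mult.commute[of "recip_ser _"]
      mu_denominator_recip by (rule mult_1_right)
  ultimately have "fps_nth ((1 - q_ser ^ 0 * X_ser 2) * (1 - q_ser ^ (0 + 1) * X_ser (-2))) 0 = 0"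
    by (metis fps_mult_nth_0 mult_zero_left)
  then have "fps_nth (fps_nth (1 - X_ser 2) 0) 0 = 0"
    by (simp add: q_ser_def fps_mult_nth_0 mult.assoc)
  then have "Poly_Mapping.lookup (1 - Poly_Mapping.single 2 1 :: int \<Rightarrow>\<^sub>0 complex) 0 = 0"
    by (simp add: X_ser_def)
  then show False
    by (simp add: lookup_minus lookup_one lookup_single)
qed

lemma mu_factor_cong_1: "fps_X ^ (2 * j) dvd mu_factor j - 1"
proof -
  let ?n = "(1 - q_ser ^ j * X_ser 2) * (1 - q_ser ^ (j + 1) * X_ser (-2))"
  let ?d = "(1 - t_ser * q_ser ^ j * X_ser 2) * (1 - t_ser * q_ser ^ (j + 1) * X_ser (-2))"
  have "mu_factor j - 1 = (?n - ?d) * recip_ser ?d"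
    unfolding mu_factor_def left_diff_distrib[of ?n ?d "recip_ser ?d"] mu_denominator_recip ..
  also have "?n - ?d = q_ser ^ j *
      (t_ser * X_ser 2 - X_ser 2 + q_ser * (t_ser * X_ser (-2) - X_ser (-2))
       + q_ser ^ (j + 1) * X_ser 2 * X_ser (-2) * (1 - t_ser ^ 2))"
    by (simp add: algebra_simps power2_eq_square)
  finally show ?thesis
    by (simp add: q_ser_def power_mult mult.assoc)
qed

lemma mu_has_prod: "mu_factor has_prod mu"
proof -
  define P where "P = (\<lambda>n. \<Prod>i\<le>n. mu_factor i)"
  have step: "fps_nth (P (Suc n)) m = fps_nth (P n) m" if "m \<le> n" for m n
  proof -
    obtain r where r: "mu_factor (Suc n) - 1 = fps_X ^ (2 * Suc n) * r"
      using mu_factor_cong_1[of "Suc n"] unfolding dvd_def by blast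
    have "P (Suc n) = P n + fps_X ^ (2 * Suc n) * (P n * r)"
      using r by (simp add: P_def algebra_simps)
    then show ?thesis
      using that by (simp only: fps_add_nth fps_X_power_mult_nth) simp
  qed
  have stable: "fps_nth (P n) m = fps_nth (P m) m" if "m \<le> n" for m n
    using that by (induction n rule: dec_induct) (simp_all add: step)
  define L where "L = Abs_fps (\<lambda>m. fps_nth (P m) m)"
  have "P \<longlonglongrightarrow> L"
    by (rule tendsto_fpsI)
       (auto simp: L_def eventually_sequentially intro!: stable)
  moreover have "L \<noteq> 0"
  proof
    assume "L = 0"
    then have "fps_nth L 0 = 0" by simp
    with mu_factor_0_nth_0 show False by (simp add: L_def P_def)
  qed
  ultimately have "mu_factor has_prod L"
    by (simp add: has_prod_def raw_has_prod_def P_def)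
  then show ?thesis
    unfolding mu_def using has_prod_unique by metis
qed

definition mu_coeff :: "int \<Rightarrow> complex fps fps" where
  "mu_coeff m =
     Abs_fps (\<lambda>i. Abs_fps (\<lambda>j. Poly_Mapping.lookup (fps_nth (fps_nth mu i) j) m))"

definition ser_of_poly :: "complex poly poly \<Rightarrow> complex fps fps" where
  "ser_of_poly p = fps_of_poly (map_poly fps_of_poly p)"

text \<open>
  \<open>mu0 m\<close> is the coefficient of \<open>X\<^sup>m\<close> in \<open>\<mu>\<^sub>k / \<langle>\<mu>\<^sub>k\<rangle>\<close>, as an element of \<open>K\<close>: the rational function
  \<open>a / b\<close> whose expansion is the quotient of the power series \<open>mu_coeff m\<close> and \<open>mu_coeff 0\<close>.
  It is unique as \<open>ser_of_poly\<close> is injective.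
\<close>

definition mu0 :: "int \<Rightarrow> K" where
  "mu0 m = (THE r. \<exists>a b. b \<noteq> 0 \<and> r = Fract a b \<and>
     ser_of_poly a * mu_coeff 0 = ser_of_poly b * mu_coeff m)"

text \<open>\<open>CT_mu0 f\<close> is the constant term \<open>\<langle>f \<mu>\<^sub>k\<^sup>0\<rangle>\<close>.\<close>

definition CT_mu0 :: "laurent \<Rightarrow> K" where
  "CT_mu0 f = (\<Sum>m\<in>Poly_Mapping.keys f. Poly_Mapping.lookup f m * mu0 (- m))"

section \<open>Nonsymmetric polynomials\<close>

text \<open>The convention here is that the sign of \<open>0\<close> is \<open>-1\<close>, in contrast to \<^const>\<open>sgn\<close>.\<close>

definition sgn_sharp :: "int \<Rightarrow> int" where
  "sgn_sharp n = (if n > 0 then 1 else - 1)"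

text \<open>\<open>q_sharp n\<close> is \<open>q\<close> to the power \<open>n\<^sub>#\<close>, the value of \<open>X\<close> at \<open>n\<^sub>#\<close>.\<close>

definition q_sharp :: "int \<Rightarrow> K" where
  "q_sharp n = qh powi n * th powi sgn_sharp n"

definition prec :: "int \<Rightarrow> int \<Rightarrow> bool" where
  "prec m n \<longleftrightarrow> \<bar>m\<bar> < \<bar>n\<bar> \<or> (m = - n \<and> m > 0)"

definition e_poly :: "int \<Rightarrow> laurent" where
  "e_poly n = (THE p.
     Poly_Mapping.lookup p n = 1 \<and>
     (\<forall>m\<in>Poly_Mapping.keys p. m = n \<or> prec m n) \<and>
     (\<forall>m. prec m n \<longrightarrow> CT_mu0 (p * X_pow (- m)) = 0))"

text \<open>The point \<open>-k/2\<close> of the normalization is \<open>0\<^sub>#\<close>.\<close>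

definition eps_poly :: "int \<Rightarrow> laurent" where
  "eps_poly n = Poly_Mapping.single 0 (inverse (L_eval (e_poly n) (q_sharp 0))) * e_poly n"

section \<open>Functions on the discrete set and the transforms\<close>

text \<open>
  The map \<open>n \<mapsto> n\<^sub>#\<close> is injective, so a finitely supported function \<open>f\<close> on \<open>\<int>\<^sub>#\<close> is encoded as
  a finitely supported function of \<open>n\<close>, whose value at \<open>n\<close> is \<open>f(n\<^sub>#)\<close>.
  For \<open>n \<noteq> 0\<close> one has \<open>-n\<^sub># = (-n)\<^sub>#\<close>.
\<close>

type_synonym dfun = "int \<Rightarrow>\<^sub>0 K"

lift_definition T_op :: "dfun \<Rightarrow> dfun" is
  "\<lambda>f n. (if n = 0 then 0
          else (th * q_sharp n ^ 2 - inverse th) / (q_sharp n ^ 2 - 1) * f (- n))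
         - (th - inverse th) / (q_sharp n ^ 2 - 1) * f n"
proof -
  fix f :: "int \<Rightarrow> K"
  assume fin: "finite {n. f n \<noteq> 0}"
  have "n \<in> uminus ` {n. f n \<noteq> 0}" if "f (- n) \<noteq> 0" for n
    using that by (intro image_eqI[of _ _ "- n"]) auto
  note * = this
  show "finite {n. (if n = 0 then 0
          else (th * q_sharp n ^ 2 - inverse th) / (q_sharp n ^ 2 - 1) * f (- n))
         - (th - inverse th) / (q_sharp n ^ 2 - 1) * f n \<noteq> 0}"
    by (rule finite_subset[of _ "{n. f n \<noteq> 0} \<union> uminus ` {n. f n \<noteq> 0}"])
       (use fin * in \<open>auto split: if_splits\<close>)
qed

text \<open>
  For every \<open>f\<close> the function \<open>n \<mapsto> \<langle>f \<epsilon>\<^sub>n \<mu>\<^sub>k\<^sup>0\<rangle>\<close> has finite support by the orthogonality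
  relations defining \<open>e\<^sub>n\<close>; \<^const>\<open>Abs_poly_mapping\<close> is meaningful only on such functions.
\<close>

definition S_trans :: "laurent \<Rightarrow> dfun" where
  "S_trans f = Abs_poly_mapping (\<lambda>n. CT_mu0 (f * eps_poly n))"

definition E_trans :: "laurent \<Rightarrow> dfun" where
  "E_trans f = Abs_poly_mapping (\<lambda>n. CT_mu0 (L_bar f * eps_poly n))"

definition mu1 :: "int \<Rightarrow> K" where
  "mu1 n = (let N = nat (if n > 0 then n - 1 else - n) in
     inverse (th ^ 2) ^ N * (\<Prod>j=1..N. (1 - (th ^ 2) ^ 2 * (qh ^ 2) ^ j) / (1 - (qh ^ 2) ^ j)))"

definition inner0 :: "laurent \<Rightarrow> laurent \<Rightarrow> K" where
  "inner0 f g = CT_mu0 (f * g)"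

definition inner1 :: "dfun \<Rightarrow> dfun \<Rightarrow> K" where
  "inner1 f g =
     (\<Sum>n\<in>Poly_Mapping.keys f. Poly_Mapping.lookup f n * Poly_Mapping.lookup g n * mu1 n)"

end

theory Submission
  imports Defs
begin

text \<open>
  The functional equation \<open>(X\<^sup>2 - t) \<mu>(q\<^sup>1\<^sup>/\<^sup>2 X) = (t X\<^sup>2 - 1) \<mu>(X)\<close> gives a first-order recurrence for the
  coefficients of \<open>\<mu>\<^sup>0\<close>; it determines them as rational functions and shows that \<open>\<mu>\<^sup>0\<close> is
  invariant under the bar involution. The polynomials \<open>e\<^sub>n\<close> are obtained from a Szego recursion with
  explicit Verblunsky coefficients: all moments \<open>\<langle>e\<^sub>n X\<^sup>j \<mu>\<^sup>0\<rangle>\<close> are products, from which orthogonality,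
  norms and the values at \<open>-k/2\<close> can be read off. The combination
  \<open>t\<^sup>-\<^sup>1\<^sup>/\<^sup>2 T \<epsilon>\<^sub>n\<close> prescribed by the operator \<open>T\<close> on functions turns out to be the bar conjugate of \<open>\<epsilon>\<^sub>n\<close>, so it is
  biorthogonal to the \<open>\<epsilon>\<^sub>m\<close> with norms \<open>1/\<mu>\<^sup>1(n\<^sub>#)\<close>; expanding \<open>f\<close> in this dual basis yields
  the first formula. The second is the first for \<open>f\<close> and \<open>g\<close> barred, as \<open>E\<close> is \<open>S\<close> composed with the bar.
\<close>

section \<open>The functional equation of the weight\<close>

definition Xcoef :: "int \<Rightarrow> series \<Rightarrow> complex fps fps" where
  "Xcoef m u = Abs_fps (\<lambda>i. Abs_fps (\<lambda>j. Poly_Mapping.lookup (fps_nth (fps_nth u i) j) m))"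

abbreviation q_fps :: "complex fps fps" where
  "q_fps \<equiv> fps_X ^ 2"

abbreviation t_fps :: "complex fps fps" where
  "t_fps \<equiv> fps_const (fps_X ^ 2)"

lemma Xcoef_nth [simp]:
  "fps_nth (fps_nth (Xcoef m u) i) j = Poly_Mapping.lookup (fps_nth (fps_nth u i) j) m"
  by (simp add: Xcoef_def)

lemma fps2_eqI: "(\<And>i j. fps_nth (fps_nth u i) j = fps_nth (fps_nth v i) j) \<Longrightarrow> u = v"
  by (simp add: fps_eq_iff)

lemma mu_coeff_eq_Xcoef: "mu_coeff m = Xcoef m mu"
  by (simp add: mu_coeff_def Xcoef_def)

lemma Xcoef_0 [simp]: "Xcoef m 0 = 0"
  by (rule fps2_eqI) simp

lemma Xcoef_add: "Xcoef m (u + v) = Xcoef m u + Xcoef m v"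
  by (rule fps2_eqI) (simp add: lookup_add)

lemma Xcoef_diff: "Xcoef m (u - v) = Xcoef m u - Xcoef m v"
  by (rule fps2_eqI) (simp add: lookup_minus)

lemma Xcoef_fps_X_power_mult: "Xcoef m (fps_X ^ k * u) = fps_X ^ k * Xcoef m u"
  by (rule fps2_eqI) (auto simp: fps_X_power_mult_nth)

lemma Xcoef_q_mult: "Xcoef m (q_ser ^ k * u) = q_fps ^ k * Xcoef m u"
  by (simp add: q_ser_def Xcoef_fps_X_power_mult flip: power_mult)

lemma Xcoef_t_mult: "Xcoef m (t_ser * u) = t_fps * Xcoef m u"
  by (rule fps2_eqI) (auto simp: t_ser_def fps_X_power_mult_nth)

lemma Xcoef_t_power_mult: "Xcoef m (t_ser ^ k * u) = t_fps ^ k * Xcoef m u"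
  by (induction k) (simp_all add: Xcoef_t_mult mult.assoc del: fps_const_power)

lemma lookup_single_mult:
  fixes p :: "'a::ab_group_add \<Rightarrow>\<^sub>0 'b::semiring_0"
  shows "Poly_Mapping.lookup (Poly_Mapping.single k c * p) m = c * Poly_Mapping.lookup p (m - k)"
proof -
  have eq: "(m = k + l) = (m - k = l)" for l by (auto simp: algebra_simps)
  show ?thesis
    by (simp add: lookup_mult lookup_single when_mult eq)
qed

lemma Xcoef_X_mult: "Xcoef m (X_ser k * u) = Xcoef (m - k) u"
  by (rule fps2_eqI) (simp add: X_ser_def lookup_single_mult)

lemma Xcoef_1: "Xcoef m 1 = (if m = 0 then 1 else 0)"
proof (rule fps2_eqI)
  fix i j
  show "fps_nth (fps_nth (Xcoef m 1) i) j = fps_nth (fps_nth (if m = 0 then 1 else 0) i) j"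
    by (cases "i = 0"; cases "j = 0") (auto simp: lookup_one when_def)
qed

lemma poly_mapping_sum_single:
  assumes "finite N" "Poly_Mapping.keys p \<subseteq> N"
  shows "p = (\<Sum>n\<in>N. Poly_Mapping.single n (Poly_Mapping.lookup p n))"
proof (rule poly_mapping_eqI)
  fix m
  have *: "Poly_Mapping.lookup p m = 0" if "m \<notin> N"
    using that assms(2) by (meson in_keys_iff subsetD)
  have "Poly_Mapping.lookup (\<Sum>n\<in>N. Poly_Mapping.single n (Poly_Mapping.lookup p n)) m =
      (\<Sum>n\<in>N. if n = m then Poly_Mapping.lookup p n else 0)"
    by (simp add: lookup_sum lookup_single when_def)
  also have "\<dots> = Poly_Mapping.lookup p m"
    using assms(1) * by simp
  finally show "Poly_Mapping.lookup p m =
      Poly_Mapping.lookup (\<Sum>n\<in>N. Poly_Mapping.single n (Poly_Mapping.lookup p n)) m" ..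
qed

lemma lookup_mult_sum:
  fixes p :: "'a::ab_group_add \<Rightarrow>\<^sub>0 'b::semiring_0"
  assumes "finite N" "Poly_Mapping.keys p \<subseteq> N"
  shows "Poly_Mapping.lookup (p * r) m =
    (\<Sum>n\<in>N. Poly_Mapping.lookup p n * Poly_Mapping.lookup r (m - n))"
proof -
  have "Poly_Mapping.lookup (p * r) m =
      Poly_Mapping.lookup ((\<Sum>n\<in>N. Poly_Mapping.single n (Poly_Mapping.lookup p n)) * r) m"
    using poly_mapping_sum_single[OF assms] by (rule arg_cong)
  then show ?thesis
    by (simp only: sum_distrib_right lookup_sum lookup_single_mult)
qed

text \<open>Convolution in \<open>X\<close> has infinitely many terms, but up to order
  \<open>(k, l)\<close> in the other two variables only finitely many exponents of \<open>u\<close>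
  occur. Allowing every finite superset lets two products share one index set.\<close>

lemma Xcoef_mult_nth:
  "\<exists>M. finite M \<and> (\<forall>N. finite N \<longrightarrow> M \<subseteq> N \<longrightarrow> (\<forall>i\<le>k. \<forall>j\<le>l.
     fps_nth (fps_nth (Xcoef m (u * v)) i) j =
     fps_nth (fps_nth (\<Sum>n\<in>N. Xcoef n u * Xcoef (m - n) v) i) j))"
proof -
  define M where "M = (\<Union>a\<le>k. \<Union>b\<le>l. Poly_Mapping.keys (fps_nth (fps_nth u a) b))"
  have "fps_nth (fps_nth (Xcoef m (u * v)) i) j =
     fps_nth (fps_nth (\<Sum>n\<in>N. Xcoef n u * Xcoef (m - n) v) i) j"
    if N: "finite N" "M \<subseteq> N" and ij: "i \<le> k" "j \<le> l" for N i j
  proof -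
    have sub: "Poly_Mapping.keys (fps_nth (fps_nth u a) b) \<subseteq> N" if "a \<in> {0..i}" "b \<in> {0..j}" for a b
      using N(2) ij that unfolding M_def by (fastforce dest: subsetD)
    have "fps_nth (fps_nth (Xcoef m (u * v)) i) j =
      (\<Sum>a=0..i. \<Sum>b=0..j. \<Sum>n\<in>N. Poly_Mapping.lookup (fps_nth (fps_nth u a) b) n *
         Poly_Mapping.lookup (fps_nth (fps_nth v (i - a)) (j - b)) (m - n))"
      unfolding Xcoef_nth fps_mult_nth fps_sum_nth lookup_sum
      by (intro sum.cong refl lookup_mult_sum) (use N(1) sub in auto)
    also have "\<dots> = (\<Sum>a=0..i. \<Sum>n\<in>N. \<Sum>b=0..j. Poly_Mapping.lookup (fps_nth (fps_nth u a) b) n *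
         Poly_Mapping.lookup (fps_nth (fps_nth v (i - a)) (j - b)) (m - n))"
      by (intro sum.cong refl sum.swap)
    also have "\<dots> = (\<Sum>n\<in>N. \<Sum>a=0..i. \<Sum>b=0..j. Poly_Mapping.lookup (fps_nth (fps_nth u a) b) n *
         Poly_Mapping.lookup (fps_nth (fps_nth v (i - a)) (j - b)) (m - n))"
      by (rule sum.swap)
    also have "\<dots> = fps_nth (fps_nth (\<Sum>n\<in>N. Xcoef n u * Xcoef (m - n) v) i) j"
      by (simp add: fps_sum_nth fps_mult_nth)
    finally show ?thesis .
  qed
  moreover have "finite M" by (simp add: M_def)
  ultimately show ?thesis by blast
qed

text \<open>
  \<open>shift_rel y u u'\<close> says \<open>u'(X) = u(y X)\<close>. The power \<open>y\<^sup>l\<close> clears the denominators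
  which the substitution creates in the coefficients of negative powers of \<open>X\<close>.
\<close>

definition shift_rel :: "complex fps fps \<Rightarrow> series \<Rightarrow> series \<Rightarrow> bool" where
  "shift_rel y u u' \<longleftrightarrow>
     (\<forall>m l. 0 \<le> m + int l \<longrightarrow> y ^ l * Xcoef m u' = y ^ nat (m + int l) * Xcoef m u)"

section \<open>Closure of the substitution relation under ring operations and reciprocals\<close>

lemma shift_relD:
  "shift_rel y u u' \<Longrightarrow> 0 \<le> m + int l \<Longrightarrow> y ^ l * Xcoef m u' = y ^ nat (m + int l) * Xcoef m u"
  by (simp add: shift_rel_def)

lemma shift_rel_1: "shift_rel y 1 1"
  by (auto simp: shift_rel_def Xcoef_1)

lemma shift_rel_0: "shift_rel y 0 0"
  by (simp add: shift_rel_def)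

lemma shift_rel_add: "shift_rel y u u' \<Longrightarrow> shift_rel y v v' \<Longrightarrow> shift_rel y (u + v) (u' + v')"
  by (simp add: shift_rel_def Xcoef_add distrib_left)

lemma shift_rel_diff: "shift_rel y u u' \<Longrightarrow> shift_rel y v v' \<Longrightarrow> shift_rel y (u - v) (u' - v')"
  by (simp add: shift_rel_def Xcoef_diff right_diff_distrib)

lemma shift_rel_t: "shift_rel y u u' \<Longrightarrow> shift_rel y (t_ser * u) (t_ser * u')"
  by (auto simp add: shift_rel_def Xcoef_t_mult mult.left_commute[of _ t_fps])

text \<open>The relation holds for each term of the convolution; comparing one coefficient at a time
  keeps all sums finite.\<close>

lemma shift_rel_mult:
  assumes y: "y \<noteq> 0" and u: "shift_rel y u u'" and v: "shift_rel y v v'"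
  shows "shift_rel y (u * v) (u' * v')"
  unfolding shift_rel_def
proof (intro allI impI)
  fix m :: int and l :: nat
  assume ml: "0 \<le> m + int l"
  define h where "h = nat (m + int l)"
  have term_eq: "y ^ l * (Xcoef n u' * Xcoef (m - n) v') = y ^ h * (Xcoef n u * Xcoef (m - n) v)" for n
  proof -
    \<comment> \<open>These make the exponents \<open>n + int a\<close> and
      \<open>m - n + int b\<close> nonnegative, so that both hypotheses apply; the surplus
      \<open>y ^ (a + b)\<close> is cancelled at the end.\<close>
    define a b where "a = nat \<bar>n\<bar>" and "b = nat \<bar>m - n\<bar>"
    have 1: "y ^ a * Xcoef n u' = y ^ nat (n + int a) * Xcoef n u"
      by (rule shift_relD[OF u]) (simp add: a_def)
    have 2: "y ^ b * Xcoef (m - n) v' = y ^ nat (m - n + int b) * Xcoef (m - n) v"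
      by (rule shift_relD[OF v]) (simp add: b_def)
    have e: "nat (n + int a) + nat (m - n + int b) + l = h + (a + b)"
      using ml by (simp add: a_def b_def h_def)
    have "y ^ (a + b) * (y ^ l * (Xcoef n u' * Xcoef (m - n) v')) =
        y ^ l * ((y ^ a * Xcoef n u') * (y ^ b * Xcoef (m - n) v'))"
      by (simp add: power_add mult_ac)
    also have "\<dots> = y ^ (nat (n + int a) + nat (m - n + int b) + l) * (Xcoef n u * Xcoef (m - n) v)"
      unfolding 1 2 by (simp add: power_add mult_ac)
    also have "\<dots> = y ^ (a + b) * (y ^ h * (Xcoef n u * Xcoef (m - n) v))"
      unfolding e by (simp add: power_add mult_ac)
    finally show ?thesis using y by simp
  qed
  show "y ^ l * Xcoef m (u' * v') = y ^ nat (m + int l) * Xcoef m (u * v)"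
  proof (rule fps2_eqI)
    fix i j
    obtain M where M: "finite M" "\<forall>N. finite N \<longrightarrow> M \<subseteq> N \<longrightarrow> (\<forall>i'\<le>i. \<forall>j'\<le>j.
       fps_nth (fps_nth (Xcoef m (u * v)) i') j' =
       fps_nth (fps_nth (\<Sum>n\<in>N. Xcoef n u * Xcoef (m - n) v) i') j')"
      using Xcoef_mult_nth[of i j m u v] by (elim exE conjE)
    obtain M' where M': "finite M'" "\<forall>N. finite N \<longrightarrow> M' \<subseteq> N \<longrightarrow> (\<forall>i'\<le>i. \<forall>j'\<le>j.
       fps_nth (fps_nth (Xcoef m (u' * v')) i') j' =
       fps_nth (fps_nth (\<Sum>n\<in>N. Xcoef n u' * Xcoef (m - n) v') i') j')"
      using Xcoef_mult_nth[of i j m u' v'] by (elim exE conjE)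
    define N where "N = M \<union> M'"
    \<comment> \<open>A coefficient of a product depends only on coefficients of lower or equal
      order, so the truncated convolution may be multiplied by a power of \<open>y\<close>.\<close>
    have trunc: "fps_nth (fps_nth (z * c) i) j = fps_nth (fps_nth (z * d) i) j"
      if "\<And>i' j'. i' \<le> i \<Longrightarrow> j' \<le> j \<Longrightarrow> fps_nth (fps_nth c i') j' = fps_nth (fps_nth d i') j'"
      for z c d :: "complex fps fps"
      unfolding fps_mult_nth fps_sum_nth by (intro sum.cong refl) (auto intro: that)
    have "fps_nth (fps_nth (y ^ l * Xcoef m (u' * v')) i) j =
        fps_nth (fps_nth (y ^ l * (\<Sum>n\<in>N. Xcoef n u' * Xcoef (m - n) v')) i) j"
      by (rule trunc, rule M'(2)[rule_format]) (use M(1) M'(1) in \<open>simp_all add: N_def\<close>)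
    also have "y ^ l * (\<Sum>n\<in>N. Xcoef n u' * Xcoef (m - n) v') =
        y ^ h * (\<Sum>n\<in>N. Xcoef n u * Xcoef (m - n) v)"
      by (simp add: sum_distrib_left term_eq)
    also have "fps_nth (fps_nth (y ^ h * (\<Sum>n\<in>N. Xcoef n u * Xcoef (m - n) v)) i) j =
        fps_nth (fps_nth (y ^ h * Xcoef m (u * v)) i) j"
      by (rule trunc, rule M(2)[rule_format, symmetric]) (use M(1) M'(1) in \<open>simp_all add: N_def\<close>)
    finally show "fps_nth (fps_nth (y ^ l * Xcoef m (u' * v')) i) j =
        fps_nth (fps_nth (y ^ nat (m + int l) * Xcoef m (u * v)) i) j"
      by (simp add: h_def)
  qed
qed

lemma shift_rel_power: "y \<noteq> 0 \<Longrightarrow> shift_rel y u u' \<Longrightarrow> shift_rel y (u ^ k) (u' ^ k)"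
  by (induction k) (simp_all add: shift_rel_1 shift_rel_mult)

lemma shift_rel_sum:
  "(\<And>a. a \<in> A \<Longrightarrow> shift_rel y (f a) (f' a)) \<Longrightarrow> shift_rel y (sum f A) (sum f' A)"
  by (induction A rule: infinite_finite_induct) (simp_all add: shift_rel_0 shift_rel_add)

lemma shift_rel_prod:
  "y \<noteq> 0 \<Longrightarrow> (\<And>a. a \<in> A \<Longrightarrow> shift_rel y (f a) (f' a)) \<Longrightarrow> shift_rel y (prod f A) (prod f' A)"
  by (induction A rule: infinite_finite_induct) (simp_all add: shift_rel_1 shift_rel_mult)

text \<open>Every multiple of \<open>t_fps ^ Suc j\<close> has inner order above \<open>j\<close>.
  This and its \<open>q\<close>-adic twin turn congruences modulo all powers into
  equalities.\<close>

lemma eq_0_if_t_power_dvd: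
  assumes "\<And>k. t_fps ^ k dvd d"
  shows "d = 0"
proof (rule fps2_eqI)
  fix i j
  obtain w where w: "d = t_fps ^ Suc j * w" using assms[of "Suc j"] by blast
  show "fps_nth (fps_nth d i) j = fps_nth (fps_nth 0 i) j"
    by (simp add: w fps_X_power_mult_nth del: power_Suc flip: power_mult)
qed

lemma eq_0_if_q_power_dvd:
  assumes "\<And>k. q_fps ^ k dvd d"
  shows "d = (0 :: complex fps fps)"
proof (rule fps_ext)
  fix i
  obtain w where w: "d = q_fps ^ Suc i * w" using assms[of "Suc i"] by blast
  show "fps_nth d i = fps_nth 0 i"
    by (simp add: w fps_X_power_mult_nth del: power_Suc flip: power_mult)
qed

text \<open>Modulo \<open>x ^ k\<close> the reciprocal is a polynomial in \<open>x\<close>, and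
  polynomials are compatible with the substitution.\<close>

lemma recip_truncated_geometric:
  assumes "(1 - x) * w = (1 :: 'a :: comm_ring_1)"
  shows "w = (\<Sum>n<k. x ^ n) + x ^ k * w"
proof -
  have "(1 - x) * (\<Sum>n<k. x ^ n) = 1 - x ^ k"
    by (simp add: one_diff_power_eq)
  then have "(1 - x) * w * (\<Sum>n<k. x ^ n) = (1 - x ^ k) * w"
    by (simp add: mult_ac)
  then have "(\<Sum>n<k. x ^ n) = w - x ^ k * w"
    unfolding assms by (simp add: left_diff_distrib)
  then show ?thesis by simp
qed

text \<open>Both reciprocals agree modulo \<open>t ^ k\<close> with the same polynomial in
  \<open>t_ser * a\<close> or \<open>t_ser * a'\<close>. The approximation is \<open>t\<close>-adic
  because for \<open>j = 0\<close> the denominator of the weight has a term without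
  \<open>q\<close>.\<close>

lemma shift_rel_recip:
  assumes y: "y \<noteq> 0" and a: "shift_rel y a a'"
    and w: "(1 - t_ser * a) * w = 1" and w': "(1 - t_ser * a') * w' = 1"
  shows "shift_rel y w w'"
  unfolding shift_rel_def
proof (intro allI impI)
  fix m :: int and l :: nat
  assume ml: "0 \<le> m + int l"
  have "t_fps ^ k dvd y ^ l * Xcoef m w' - y ^ nat (m + int l) * Xcoef m w" for k
  proof -
    have "shift_rel y (\<Sum>n<k. (t_ser * a) ^ n) (\<Sum>n<k. (t_ser * a') ^ n)"
      by (intro shift_rel_sum shift_rel_power shift_rel_t y a)
    note s = shift_relD[OF this ml]
    have 1: "Xcoef m w = Xcoef m (\<Sum>n<k. (t_ser * a) ^ n) + t_fps ^ k * Xcoef m (a ^ k * w)"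
      by (subst recip_truncated_geometric[OF w, of k])
         (simp add: Xcoef_add power_mult_distrib mult.assoc Xcoef_t_power_mult del: fps_const_power)
    have 2: "Xcoef m w' = Xcoef m (\<Sum>n<k. (t_ser * a') ^ n) + t_fps ^ k * Xcoef m (a' ^ k * w')"
      by (subst recip_truncated_geometric[OF w', of k])
         (simp add: Xcoef_add power_mult_distrib mult.assoc Xcoef_t_power_mult del: fps_const_power)
    have "y ^ l * Xcoef m w' - y ^ nat (m + int l) * Xcoef m w =
       t_fps ^ k * (y ^ l * Xcoef m (a' ^ k * w') - y ^ nat (m + int l) * Xcoef m (a ^ k * w))"
      unfolding 1 2 using s by (simp add: algebra_simps del: fps_const_power)
    then show ?thesis by simp
  qed
  from eq_0_if_t_power_dvd[OF this]
  show "y ^ l * Xcoef m w' = y ^ nat (m + int l) * Xcoef m w" by simp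
qed

text \<open>Only the square of \<open>y\<close> is prescribed, so both roots \<open>fps_X\<close>
  and \<open>- fps_X\<close> of \<open>q\<close> qualify; comparing them later gives the parity of
  the weight.\<close>

lemma shift_rel_X2:
  assumes "y ^ 2 = q_fps"
  shows "shift_rel y (q_ser ^ j * X_ser 2) (q_ser ^ (j + 1) * X_ser 2)"
proof -
  have x: "Xcoef m (q_ser ^ i * X_ser 2) = q_fps ^ i * (if m = 2 then 1 else 0)" for m i
  proof -
    have "Xcoef m (q_ser ^ i * (X_ser 2 * 1)) = q_fps ^ i * (if m - 2 = 0 then 1 else 0)"
      by (simp only: Xcoef_q_mult Xcoef_X_mult Xcoef_1)
    then show ?thesis by (cases "m = 2") auto
  qed
  have "y ^ l * q_fps ^ (j + 1) = y ^ nat (2 + int l) * q_fps ^ j" for l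
  proof -
    have "nat (2 + int l) = l + 2" by simp
    then show ?thesis by (simp only: power_add assms power_one_right mult_ac)
  qed
  then show ?thesis
    unfolding shift_rel_def x by auto
qed

lemma shift_rel_X_minus2:
  assumes "y ^ 2 = q_fps"
  shows "shift_rel y (q_ser ^ (j + 1) * X_ser (-2)) (q_ser ^ j * X_ser (-2))"
proof -
  have x: "Xcoef m (q_ser ^ i * X_ser (-2)) = q_fps ^ i * (if m = -2 then 1 else 0)" for m i
  proof -
    have "Xcoef m (q_ser ^ i * (X_ser (-2) * 1)) = q_fps ^ i * (if m - (-2) = 0 then 1 else 0)"
      by (simp only: Xcoef_q_mult Xcoef_X_mult Xcoef_1)
    then show ?thesis by (cases "m = -2") auto
  qed
  have "y ^ l * q_fps ^ j = y ^ nat (- 2 + int l) * q_fps ^ (j + 1)" if "0 \<le> - 2 + int l" for l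
  proof -
    define k where "k = nat (- 2 + int l)"
    have "l = k + 2" using that by (simp add: k_def)
    then have "y ^ l * q_fps ^ j = y ^ k * q_fps ^ (j + 1)"
      by (simp only: power_add assms power_one_right mult_ac)
    then show ?thesis by (simp add: k_def)
  qed
  then show ?thesis
    unfolding shift_rel_def x by auto
qed

text \<open>The substitution \<open>X \<mapsto> q\<^sup>1\<^sup>/\<^sup>2 X\<close> applied to \<^const>\<open>mu_factor\<close>.\<close>

definition mu_factor_shift :: "nat \<Rightarrow> series" where
  "mu_factor_shift j =
     (1 - q_ser ^ (j + 1) * X_ser 2) * (1 - q_ser ^ j * X_ser (-2)) *
     recip_ser ((1 - t_ser * q_ser ^ (j + 1) * X_ser 2) * (1 - t_ser * q_ser ^ j * X_ser (-2)))"

lemma mu_denominator_shift_recip: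
  fixes j :: nat
  defines "d \<equiv> (1 - t_ser * q_ser ^ (j + 1) * X_ser 2) * (1 - t_ser * q_ser ^ j * X_ser (-2))"
  shows "d * recip_ser d = 1"
  by (rule recip_ser)
     (simp add: d_def t_ser_def q_ser_def X_ser_def fps_mult_nth_0 fps_nth_power_0 mult.assoc)

lemma shift_rel_mu_factor:
  assumes y: "y ^ 2 = q_fps"
  shows "shift_rel y (mu_factor j) (mu_factor_shift j)"
proof -
  let ?a = "q_ser ^ j * X_ser 2" and ?b = "q_ser ^ (j + 1) * X_ser (-2)"
  let ?a' = "q_ser ^ (j + 1) * X_ser 2" and ?b' = "q_ser ^ j * X_ser (-2)"
  have y0: "y \<noteq> 0" using y by auto
  have a: "shift_rel y ?a ?a'" and b: "shift_rel y ?b ?b'"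
    using shift_rel_X2[OF y] shift_rel_X_minus2[OF y] by blast+
  \<comment> \<open>The product of the two denominators has the form \<open>1 - t_ser * c\<close>
    that \<open>shift_rel_recip\<close> requires.\<close>
  have split: "(1 - t_ser * q1 * x1) * (1 - t_ser * q2 * x2) =
      1 - t_ser * (q1 * x1 + q2 * x2 - t_ser * ((q1 * x1) * (q2 * x2)))" for q1 x1 q2 x2
    by (simp add: algebra_simps)
  have "shift_rel y (?a + ?b - t_ser * (?a * ?b)) (?a' + ?b' - t_ser * (?a' * ?b'))"
    by (rule shift_rel_diff[OF shift_rel_add[OF a b] shift_rel_t[OF shift_rel_mult[OF y0 a b]]])
  then have "shift_rel y
      (recip_ser ((1 - t_ser * q_ser ^ j * X_ser 2) * (1 - t_ser * q_ser ^ (j + 1) * X_ser (-2))))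
      (recip_ser ((1 - t_ser * q_ser ^ (j + 1) * X_ser 2) * (1 - t_ser * q_ser ^ j * X_ser (-2))))"
    by (rule shift_rel_recip[OF y0])
       (simp_all only: split[symmetric] mu_denominator_recip mu_denominator_shift_recip)
  then show ?thesis
    unfolding mu_factor_def mu_factor_shift_def
    by (intro shift_rel_mult[OF y0 shift_rel_mult[OF y0
          shift_rel_diff[OF shift_rel_1 a] shift_rel_diff[OF shift_rel_1 b]]])
qed

section \<open>Partial products, their telescoping and the functional equation\<close>

definition mu_partial :: "nat \<Rightarrow> series" where
  "mu_partial n = (\<Prod>j<n. mu_factor j)"

definition mu_partial_shift :: "nat \<Rightarrow> series" where
  "mu_partial_shift n = (\<Prod>j<n. mu_factor_shift j)"

lemma shift_rel_mu_partial:
  assumes y: "y ^ 2 = q_fps"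
  shows "shift_rel y (mu_partial n) (mu_partial_shift n)"
  unfolding mu_partial_def mu_partial_shift_def
  by (rule shift_rel_prod) (use y in \<open>auto intro: shift_rel_mu_factor\<close>)

lemma fps_X_power_dvd_iff:
  "fps_X ^ k dvd f \<longleftrightarrow> (\<forall>i<k. fps_nth (f :: 'a :: comm_ring_1 fps) i = 0)"
proof
  assume "\<forall>i<k. fps_nth f i = 0"
  then have "f = fps_X ^ k * fps_shift k f"
    by (auto simp: fps_eq_iff fps_X_power_mult_nth)
  then show "fps_X ^ k dvd f" by (rule dvdI)
qed (auto simp: fps_X_power_mult_nth)

text \<open>Since \<open>mu_factor j\<close> is \<open>1\<close> modulo \<open>q ^ j\<close>, later
  factors do not change a partial product modulo \<open>q ^ n\<close>, and each coefficient of the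
  limit is eventually attained.\<close>

lemma mu_partial_cong: "q_ser ^ n dvd mu - mu_partial n"
proof -
  have step: "q_ser ^ j dvd mu_partial (Suc j) - mu_partial j" for j
  proof -
    have "mu_partial (Suc j) - mu_partial j = mu_partial j * (mu_factor j - 1)"
      by (simp add: mu_partial_def algebra_simps)
    then show ?thesis
      using mu_factor_cong_1[of j] by (simp add: q_ser_def flip: power_mult)
  qed
  have stable: "q_ser ^ n dvd mu_partial k - mu_partial n" if "n \<le> k" for k
    using that
  proof (induction k rule: dec_induct)
    case (step k)
    have "q_ser ^ n dvd q_ser ^ k" using step.hyps by (simp add: le_imp_power_dvd)
    also have "q_ser ^ k dvd mu_partial (Suc k) - mu_partial k" by fact
    finally have "q_ser ^ n dvd (mu_partial (Suc k) - mu_partial k) + (mu_partial k - mu_partial n)"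
      using step.IH by (rule dvd_add)
    then show ?case by simp
  qed simp
  have "fps_nth (mu - mu_partial n) i = 0" if i: "i < 2 * n" for i
  proof -
    have "mu_partial \<longlonglongrightarrow> mu"
      using has_prod_imp_tendsto'[OF mu_has_prod] by (simp add: mu_partial_def[abs_def])
    then have "eventually (\<lambda>k. fps_nth (mu_partial k) i = fps_nth mu i) sequentially"
      by (simp add: tendsto_fps_iff)
    then obtain K where K: "\<And>k. k \<ge> K \<Longrightarrow> fps_nth (mu_partial k) i = fps_nth mu i"
      by (auto simp: eventually_sequentially)
    have "fps_nth (mu_partial (max K n) - mu_partial n) i = 0"
      using stable[of "max K n"] i by (simp add: q_ser_def fps_X_power_dvd_iff flip: power_mult)
    then show ?thesis using K[of "max K n"] by simp
  qed
  then show ?thesis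
    by (simp add: q_ser_def fps_X_power_dvd_iff flip: power_mult)
qed

lemma X_ser_mult: "X_ser a * X_ser b = X_ser (a + b)"
  by (simp add: X_ser_def mult_single)

lemma X_ser_0: "X_ser 0 = 1"
  by (simp add: X_ser_def)

lemma one_minus_t_ne_0: "1 - t_ser * u \<noteq> 0"
proof
  assume "1 - t_ser * u = 0"
  then have "fps_nth (fps_nth (1 - t_ser * u) 0) 0 = 0" by simp
  then show False by (simp add: t_ser_def)
qed

lemma one_minus_X2_ne_0: "1 - X_ser 2 \<noteq> 0"
proof
  assume "1 - X_ser 2 = 0"
  then have "Poly_Mapping.lookup (fps_nth (fps_nth (1 - X_ser 2) 0) 0) 0 = 0" by simp
  then show False by (simp add: X_ser_def lookup_minus lookup_single)
qed

text \<open>The induction step below, cross-multiplied. \<open>A\<close> and \<open>B\<close> are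
  numerator factors in \<open>X^2\<close> and \<open>X^-2\<close>, primes mark denominator factors;
  suffix 0 means the initial index, no suffix the current one, suffix 1 the next.\<close>

lemma telescope_step:
  fixes P P' :: "'a :: idom"
  assumes "P' * (A0 * B'0 * (B * A')) = P * (B0 * A'0 * (A * B'))"
    and "f' * (A'1 * B') = A1 * B" and "f * (A' * B'1) = A * B1"
    and "A' \<noteq> 0" "B' \<noteq> 0"
  shows "P' * f' * (A0 * B'0 * (B1 * A'1)) = P * f * (B0 * A'0 * (A1 * B'1))"
proof -
  have "(P' * f' * (A0 * B'0 * (B1 * A'1))) * (B' * A') =
      (P' * (A0 * B'0 * (B * A'))) * (A1 * B1)"
    using assms(2) by algebra
  also have "\<dots> = P * (B0 * A'0 * (A * B')) * (A1 * B1)"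
    by (simp only: assms(1))
  also have "\<dots> = (P * f * (B0 * A'0 * (A1 * B'1))) * (B' * A')"
    using assms(3) by algebra
  finally show ?thesis using assms(4,5) by simp
qed

text \<open>In the quotient of the shifted and the original product everything cancels except the
  boundary factors at \<open>0\<close> and \<open>n\<close>; the equation is stated without
  division.\<close>

lemma mu_partial_telescope:
  "mu_partial_shift n * ((1 - X_ser 2) * (1 - t_ser * X_ser (-2)) *
     ((1 - q_ser ^ n * X_ser (-2)) * (1 - t_ser * (q_ser ^ n * X_ser 2)))) =
   mu_partial n * ((1 - X_ser (-2)) * (1 - t_ser * X_ser 2) *
     ((1 - q_ser ^ n * X_ser 2) * (1 - t_ser * (q_ser ^ n * X_ser (-2)))))"
proof (induction n)
  case 0
  then show ?case by (simp add: mu_partial_def mu_partial_shift_def)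
next
  case (Suc n)
  have 1: "mu_factor_shift n * ((1 - t_ser * (q_ser ^ Suc n * X_ser 2)) *
      (1 - t_ser * (q_ser ^ n * X_ser (-2)))) =
      (1 - q_ser ^ Suc n * X_ser 2) * (1 - q_ser ^ n * X_ser (-2))"
    using mu_denominator_shift_recip[of n]
    by (simp add: mu_factor_shift_def mult_ac)
  have 2: "mu_factor n * ((1 - t_ser * (q_ser ^ n * X_ser 2)) *
      (1 - t_ser * (q_ser ^ Suc n * X_ser (-2)))) =
      (1 - q_ser ^ n * X_ser 2) * (1 - q_ser ^ Suc n * X_ser (-2))"
    using mu_denominator_recip[of n]
    by (simp add: mu_factor_def mult_ac)
  show ?case
    using telescope_step[OF Suc.IH 1 2 one_minus_t_ne_0 one_minus_t_ne_0]
    by (simp add: mu_partial_def mu_partial_shift_def)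
qed

text \<open>From \<open>X * (1 - Y) = - (1 - X)\<close>: this exposes the factor
  \<open>1 - X\<close> common to both sides of the telescoped equation.\<close>

lemma cancel_one_minus_X2:
  fixes X Y :: "'a :: idom"
  assumes "X * Y = 1"
  shows "X * (P * ((1 - Y) * c * d)) = (1 - X) * (- (P * (c * d)))"
proof -
  have "X * (1 - Y) = - (1 - X)" using assms by (simp add: algebra_simps)
  then show ?thesis by algebra
qed

text \<open>Here \<open>q\<close> stands for \<open>q_ser ^ n\<close>. Each boundary factor at
  \<open>n\<close> is \<open>1\<close> minus a multiple of it, so the functional equation is what
  survives at \<open>q = 0\<close>, and the rest is an explicit multiple of
  \<open>q\<close>.\<close>

lemma functional_equation_remainder:
  fixes X Y :: "'a :: idom"
  assumes XY: "X * Y = 1"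
    and eq: "X * (P' * ((1 - t * Y) * ((1 - q * Y) * (1 - t * (q * X))))) =
      - (P * ((1 - t * X) * ((1 - q * X) * (1 - t * (q * Y)))))"
  shows "X * P' - t * P' + P - t * (X * P) =
    q * ((X * P' - t * P') * (Y + t * X - t * q) + P * (1 - t * X) * (X + t * Y - t * q))"
proof -
  have 1: "(1 - q * Y) * (1 - t * (q * X)) = 1 - q * (Y + t * X - t * q)"
    and 2: "(1 - q * X) * (1 - t * (q * Y)) = 1 - q * (X + t * Y - t * q)"
    and 3: "X * (P' * ((1 - t * Y) * d)) = (X * P' - t * P') * d" for d
    using XY by algebra+
  show ?thesis
    using eq unfolding 1 2 3 by algebra
qed

text \<open>The functional equation modulo \<open>q ^ n\<close>. With partial products no shifted
  infinite product has to be given a meaning.\<close>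

lemma mu_partial_functional_equation:
  "q_ser ^ n dvd X_ser 2 * mu_partial_shift n - t_ser * mu_partial_shift n
     + mu_partial n - t_ser * (X_ser 2 * mu_partial n)"
proof -
  let ?P = "mu_partial n" and ?P' = "mu_partial_shift n" and ?q = "q_ser ^ n"
  let ?X = "X_ser 2" and ?Y = "X_ser (-2)" and ?t = t_ser
  have XY: "?X * ?Y = 1" by (simp add: X_ser_mult X_ser_0)
  have "(1 - ?X) * (?X * (?P' * ((1 - ?t * ?Y) * ((1 - ?q * ?Y) * (1 - ?t * (?q * ?X)))))) =
      ?X * (?P * ((1 - ?Y) * (1 - ?t * ?X) * ((1 - ?q * ?X) * (1 - ?t * (?q * ?Y)))))"
    using mu_partial_telescope[of n] by (simp add: mult_ac)
  also have "\<dots> = (1 - ?X) * (- (?P * ((1 - ?t * ?X) * ((1 - ?q * ?X) * (1 - ?t * (?q * ?Y))))))"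
    by (rule cancel_one_minus_X2[OF XY])
  finally have *: "?X * (?P' * ((1 - ?t * ?Y) * ((1 - ?q * ?Y) * (1 - ?t * (?q * ?X))))) =
      - (?P * ((1 - ?t * ?X) * ((1 - ?q * ?X) * (1 - ?t * (?q * ?Y)))))"
    using one_minus_X2_ne_0 mult_left_cancel by blast
  show ?thesis
    unfolding functional_equation_remainder[OF XY *] by (rule dvd_triv_left)
qed

section \<open>From the functional equation to a recurrence for the coefficients\<close>

lemma q_power_dvd_XcoefI: "q_ser ^ n dvd u \<Longrightarrow> q_fps ^ n dvd Xcoef m u"
  by (auto simp: Xcoef_q_mult)

text \<open>\<open>M\<close>, \<open>M2\<close> are the coefficients of \<open>mu\<close> at
  \<open>m\<close> and \<open>m - 2\<close>, \<open>c\<close>, \<open>c2\<close> those of a partial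
  product and \<open>c'\<close>, \<open>c2'\<close> those of its shift. Each summand on the right is
  divisible by \<open>q ^ n\<close>.\<close>

lemma recurrence_remainder:
  fixes y :: "'a :: idom"
  assumes "y * c2' = h2 * c2" "y * c' = h * c"
  shows "h2 * M2 - t * (h * M) + y * (M - t * M2) =
    y * (c2' - t * c' + c - t * c2) + (h2 - y * t) * (M2 - c2) + (y - t * h) * (M - c)"
  using assms by algebra

text \<open>The coefficient of \<open>X^m\<close> in the functional equation, where the shift
  multiplies the coefficient at \<open>k\<close> by \<open>fps_X\<close> to the power
  \<open>k\<close>; \<open>l\<close> clears negative powers.\<close>

lemma mu_coeff_recurrence:
  assumes l: "0 \<le> m - 2 + int l"
  shows "fps_X ^ nat (m - 2 + int l) * mu_coeff (m - 2) - t_fps * (fps_X ^ nat (m + int l) * mu_coeff m)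
    + fps_X ^ l * (mu_coeff m - t_fps * mu_coeff (m - 2)) = 0"
proof (rule eq_0_if_q_power_dvd)
  fix n
  let ?y = "fps_X :: complex fps fps"
  let ?c = "\<lambda>k. Xcoef k (mu_partial n)" and ?c' = "\<lambda>k. Xcoef k (mu_partial_shift n)"
  have d: "q_fps ^ n dvd mu_coeff k - ?c k" for k
    using q_power_dvd_XcoefI[OF mu_partial_cong, of n k] by (simp add: Xcoef_diff mu_coeff_eq_Xcoef)
  have e: "q_fps ^ n dvd ?c' (m - 2) - t_fps * ?c' m + ?c m - t_fps * ?c (m - 2)"
    using q_power_dvd_XcoefI[OF mu_partial_functional_equation, of n m]
    by (simp add: Xcoef_diff Xcoef_add Xcoef_X_mult Xcoef_t_mult)
  have s: "?y ^ l * ?c' k = ?y ^ nat (k + int l) * ?c k" if "0 \<le> k + int l" for k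
    by (rule shift_relD[OF shift_rel_mu_partial that]) simp
  have s1: "?y ^ l * ?c' (m - 2) = ?y ^ nat (m - 2 + int l) * ?c (m - 2)"
    and s2: "?y ^ l * ?c' m = ?y ^ nat (m + int l) * ?c m"
    using s l by auto
  have "?y ^ nat (m - 2 + int l) * mu_coeff (m - 2) - t_fps * (?y ^ nat (m + int l) * mu_coeff m)
    + ?y ^ l * (mu_coeff m - t_fps * mu_coeff (m - 2)) =
      ?y ^ l * (?c' (m - 2) - t_fps * ?c' m + ?c m - t_fps * ?c (m - 2))
      + (?y ^ nat (m - 2 + int l) - ?y ^ l * t_fps) * (mu_coeff (m - 2) - ?c (m - 2))
      + (?y ^ l - t_fps * ?y ^ nat (m + int l)) * (mu_coeff m - ?c m)"
    by (rule recurrence_remainder[OF s1 s2])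
  also have "q_fps ^ n dvd \<dots>"
    by (intro dvd_add dvd_mult d e)
  finally show "q_fps ^ n dvd ?y ^ nat (m - 2 + int l) * mu_coeff (m - 2)
    - t_fps * (?y ^ nat (m + int l) * mu_coeff m) + ?y ^ l * (mu_coeff m - t_fps * mu_coeff (m - 2))" .
qed

text \<open>The same shifted product belongs to \<open>fps_X\<close> and to \<open>- fps_X\<close>.
  For odd \<open>m\<close> the two relations differ by a sign, so the coefficient is zero in every
  partial product.\<close>

lemma mu_coeff_odd:
  assumes "odd m"
  shows "mu_coeff m = 0"
proof (rule eq_0_if_q_power_dvd)
  fix n
  let ?y = "fps_X :: complex fps fps"
  define l where "l = nat \<bar>m\<bar>"
  have ml: "0 \<le> m + int l" by (simp add: l_def)
  have parity: "odd (nat (m + int l) + l)"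
    using assms by (simp add: l_def even_nat_iff)
  have 1: "?y ^ l * Xcoef m (mu_partial_shift n) = ?y ^ nat (m + int l) * Xcoef m (mu_partial n)"
    by (rule shift_relD[OF shift_rel_mu_partial ml]) simp
  have "(- ?y) ^ l * Xcoef m (mu_partial_shift n) = (- ?y) ^ nat (m + int l) * Xcoef m (mu_partial n)"
    by (rule shift_relD[OF shift_rel_mu_partial ml]) simp
  then have "?y ^ l * Xcoef m (mu_partial_shift n) = - (?y ^ nat (m + int l) * Xcoef m (mu_partial n))"
    using parity by (cases "even l") (auto simp: eq_neg_iff_add_eq_0 neg_eq_iff_add_eq_0)
  with 1 have "2 * (?y ^ nat (m + int l) * Xcoef m (mu_partial n)) = 0" by simp
  then have "Xcoef m (mu_partial n) = 0" by simp
  then show "q_fps ^ n dvd mu_coeff m"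
    using q_power_dvd_XcoefI[OF mu_partial_cong, of n m] by (simp add: Xcoef_diff mu_coeff_eq_Xcoef)
qed

text \<open>At \<open>q = t = 0\<close> the weight reduces to \<open>1 - X^2\<close>, whose constant
  term is \<open>1\<close>.\<close>

lemma mu_coeff_0_ne_0: "mu_coeff 0 \<noteq> 0"
proof -
  have "fps_nth (fps_nth (mu_factor 0) 0) 0 = 1 - X_pow 2"
  proof -
    let ?d = "(1 - t_ser * X_ser 2) * (1 - t_ser * q_ser * X_ser (-2))"
    have "mu_factor 0 * ?d = (1 - X_ser 2) * (1 - q_ser * X_ser (-2))"
      using mu_denominator_recip[of 0] by (simp add: mu_factor_def mult_ac)
    then have "fps_nth (fps_nth (mu_factor 0 * ?d) 0) 0 =
        fps_nth (fps_nth ((1 - X_ser 2) * (1 - q_ser * X_ser (-2))) 0) 0" by simp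
    then show ?thesis by (simp add: fps_mult_nth_0 t_ser_def q_ser_def X_ser_def mult.assoc)
  qed
  moreover have "fps_nth mu 0 = fps_nth (mu_factor 0) 0"
    using mu_partial_cong[of 1] by (auto simp: mu_partial_def q_ser_def fps_X_power_dvd_iff)
  ultimately have "fps_nth (fps_nth (mu_coeff 0) 0) 0 = 1"
    by (simp add: mu_coeff_def lookup_minus lookup_one lookup_single)
  then show ?thesis by auto
qed

section \<open>The coefficients of the normalized weight\<close>

abbreviation qK :: K where "qK \<equiv> qh ^ 2"
abbreviation tK :: K where "tK \<equiv> th ^ 2"

section \<open>Independence of \<open>qh\<close> and \<open>th\<close>, and factors that never
  vanish\<close>

lemma qh_th_monomial: "qh ^ b * th ^ a = Fract (monom (monom 1 a) b) 1"
  by (simp add: qh_power th_power smult_monom mult.commute[of "monom 1 b"])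

lemma qh_th_power_eq_iff: "qh ^ b * th ^ a = qh ^ d * th ^ c \<longleftrightarrow> b = d \<and> a = c"
  by (auto simp: qh_th_monomial eq_fract monom_eq_iff')

lemma power_nat_shift:
  assumes "0 \<le> k + int l" "(x :: 'a :: field) \<noteq> 0"
  shows "x ^ nat (k + int l) = x ^ l * x powi k"
proof -
  have "x ^ nat (k + int l) = x powi (k + int l)"
    using assms by (simp only: power_int_nonneg_exp)
  also have "\<dots> = x powi k * x powi int l"
    using assms by (intro power_int_add) auto
  finally show ?thesis by simp
qed

text \<open>Multiplying by \<open>qh ^ k * th ^ k\<close> reduces to ordinary monomials. The
  nonvanishing of all the denominators below rests on this.\<close>

lemma th_qh_power_int_eq_1_iff: "th powi a * qh powi b = 1 \<longleftrightarrow> a = 0 \<and> b = 0"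
proof
  assume 1: "th powi a * qh powi b = 1"
  define k where "k = nat (max \<bar>a\<bar> \<bar>b\<bar>)"
  have k: "0 \<le> b + int k" "0 \<le> a + int k" by (auto simp: k_def)
  have "qh ^ nat (b + int k) * th ^ nat (a + int k) = (th powi a * qh powi b) * (qh ^ k * th ^ k)"
    using k by (simp add: power_nat_shift)
  then have "nat (b + int k) = k \<and> nat (a + int k) = k"
    by (simp only: 1 mult_1_left qh_th_power_eq_iff)
  then show "a = 0 \<and> b = 0" using k by linarith
qed simp

lemma qK_power_int: "qK powi m = qh powi (2 * m)"
  by (simp add: power_int_mult)

lemma one_minus_q_ne_0: "m \<noteq> 0 \<Longrightarrow> 1 - qK powi m \<noteq> 0"
  using th_qh_power_int_eq_1_iff[of 0 "2 * m"] by (auto simp: qK_power_int)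

lemma one_minus_tq_ne_0: "1 - tK * qK powi m \<noteq> 0"
  using th_qh_power_int_eq_1_iff[of 2 "2 * m"] by (auto simp: qK_power_int)

lemma one_minus_t2q_ne_0: "1 - tK ^ 2 * qK powi m \<noteq> 0"
  using th_qh_power_int_eq_1_iff[of 4 "2 * m"] by (auto simp: qK_power_int simp flip: power_mult)

lemma t_minus_q_ne_0: "tK - qK powi m \<noteq> 0"
  using th_qh_power_int_eq_1_iff[of 2 "- 2 * m"] by (auto simp: qK_power_int power_int_minus)

section \<open>Ratios of power series as elements of \<open>K\<close>\<close>

lemma ser_of_poly_0 [simp]: "ser_of_poly 0 = 0"
  by (simp add: ser_of_poly_def)

lemma ser_of_poly_1 [simp]: "ser_of_poly 1 = 1"
  by (simp add: ser_of_poly_def map_poly_1')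

lemma ser_of_poly_add: "ser_of_poly (p + r) = ser_of_poly p + ser_of_poly r"
  by (simp add: ser_of_poly_def map_poly_hom_add fps_of_poly_add)

lemma ser_of_poly_mult: "ser_of_poly (p * r) = ser_of_poly p * ser_of_poly r"
  by (simp add: ser_of_poly_def map_poly_hom_mult fps_of_poly_add fps_of_poly_mult)

lemma ser_of_poly_eq_0_iff [simp]: "ser_of_poly p = 0 \<longleftrightarrow> p = 0"
proof
  assume "ser_of_poly p = 0"
  then have "map_poly fps_of_poly p = 0"
    using fps_of_poly_eq_iff[of "map_poly fps_of_poly p" 0] by (simp add: ser_of_poly_def)
  then have "fps_of_poly (coeff p i) = 0" for i
    by (metis coeff_0 coeff_map_poly fps_of_poly_0)
  then have "coeff p i = 0" for i
    using fps_of_poly_eq_iff[of _ 0] by (metis fps_of_poly_0)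
  then show "p = 0" by (intro poly_eqI) simp
qed simp

lemma ser_of_poly_diff: "ser_of_poly (p - r) = ser_of_poly p - ser_of_poly r"
  using ser_of_poly_add[of "p - r" r] by simp

lemma ser_of_poly_monom: "ser_of_poly (monom (monom 1 a) b) = fps_X ^ b * fps_const (fps_X ^ a)"
  by (simp add: ser_of_poly_def map_poly_monom fps_of_poly_monom mult.commute)

text \<open>The relation inside the description defining \<open>mu0\<close>, named so that it can be
  propagated along the recurrence.\<close>

definition mu_ratio :: "int \<Rightarrow> K \<Rightarrow> bool" where
  "mu_ratio m r \<longleftrightarrow> (\<exists>a b. b \<noteq> 0 \<and> r = Fract a b \<and>
     ser_of_poly a * mu_coeff 0 = ser_of_poly b * mu_coeff m)"

lemma mu_ratio_unique:
  assumes "mu_ratio m r" "mu_ratio m s"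
  shows "r = s"
proof -
  obtain a b where 1: "b \<noteq> 0" "r = Fract a b" "ser_of_poly a * mu_coeff 0 = ser_of_poly b * mu_coeff m"
    using assms(1) by (auto simp: mu_ratio_def)
  obtain c d where 2: "d \<noteq> 0" "s = Fract c d" "ser_of_poly c * mu_coeff 0 = ser_of_poly d * mu_coeff m"
    using assms(2) by (auto simp: mu_ratio_def)
  have "ser_of_poly (a * d - c * b) * mu_coeff 0 =
      ser_of_poly d * (ser_of_poly a * mu_coeff 0) - ser_of_poly b * (ser_of_poly c * mu_coeff 0)"
    by (simp add: ser_of_poly_diff ser_of_poly_mult algebra_simps)
  also have "\<dots> = 0" unfolding 1 2 by (simp add: mult_ac)
  finally have "a * d - c * b = 0" using mu_coeff_0_ne_0 by simp
  then show ?thesis using 1 2 by (simp add: eq_fract)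
qed

lemma mu0_eqI: "mu_ratio m r \<Longrightarrow> mu0 m = r"
  unfolding mu0_def mu_ratio_def[symmetric]
  by (rule the_equality) (auto intro: mu_ratio_unique)

lemma mu_ratio_0: "mu_ratio 0 1"
  unfolding mu_ratio_def by (rule exI[of _ 1], rule exI[of _ 1]) (simp add: One_fract_def)

lemma mu_ratio_odd: "odd m \<Longrightarrow> mu_ratio m 0"
  unfolding mu_ratio_def
  by (rule exI[of _ 0], rule exI[of _ 1]) (simp add: Zero_fract_def mu_coeff_odd)

lemma mu_ratio_step:
  assumes "mu_ratio m r" "d \<noteq> 0" "ser_of_poly d * mu_coeff m' = ser_of_poly n * mu_coeff m"
  shows "mu_ratio m' (r * Fract n d)"
proof -
  obtain a b where 1: "b \<noteq> 0" "r = Fract a b" "ser_of_poly a * mu_coeff 0 = ser_of_poly b * mu_coeff m"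
    using assms(1) by (auto simp: mu_ratio_def)
  have "ser_of_poly (a * n) * mu_coeff 0 = ser_of_poly n * (ser_of_poly a * mu_coeff 0)"
    by (simp add: ser_of_poly_mult mult_ac)
  also have "\<dots> = ser_of_poly b * (ser_of_poly n * mu_coeff m)"
    unfolding 1(3) by (simp only: mult_ac)
  also have "\<dots> = ser_of_poly (b * d) * mu_coeff m'"
    unfolding assms(3)[symmetric] by (simp only: ser_of_poly_mult mult_ac)
  finally show ?thesis
    unfolding mu_ratio_def using 1 assms(2) by (intro exI[of _ "a * n"] exI[of _ "b * d"]) simp
qed

text \<open>With \<open>l\<close> large enough for all exponents to be nonnegative, the recurrence
  has polynomial coefficients. Both are nonzero, so it can be run upwards and downwards.\<close>

lemma mu_coeff_recurrence_poly:
  fixes m :: int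
  obtains d n where
    "ser_of_poly d * mu_coeff (2 * m) = ser_of_poly n * mu_coeff (2 * m - 2)"
    "d \<noteq> 0" "n \<noteq> 0" "Fract n d = (tK - qK powi (m - 1)) / (1 - tK * qK powi m)"
proof -
  define l where "l = nat (2 * \<bar>m\<bar> + 2)"
  define i j where "i = nat (2 * m - 2 + int l)" and "j = nat (2 * m + int l)"
  define d n :: "complex poly poly" where "d = monom (monom 1 0) l - monom (monom 1 2) j"
    and "n = monom (monom 1 2) l - monom (monom 1 0) i"
  have l: "0 \<le> 2 * m - 2 + int l" by (simp add: l_def)
  have sd: "ser_of_poly d = fps_X ^ l - fps_X ^ j * t_fps"
    and sn: "ser_of_poly n = fps_X ^ l * t_fps - fps_X ^ i"
    unfolding d_def n_def ser_of_poly_diff ser_of_poly_monom by simp_all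
  have rec: "ser_of_poly d * mu_coeff (2 * m) = ser_of_poly n * mu_coeff (2 * m - 2)"
    using mu_coeff_recurrence[OF l] unfolding sd sn
    by (simp add: i_def j_def algebra_simps)
  have F: "Fract (p - r) 1 = Fract p 1 - Fract r 1" for p r :: "complex poly poly" by simp
  have 1: "Fract d 1 = qh ^ l * (1 - tK * qK powi m)"
  proof -
    have "Fract d 1 = qh ^ l - qh ^ j * tK"
      unfolding d_def F qh_th_monomial[symmetric] by simp
    also have "qh ^ j = qh ^ l * qK powi m"
      using l by (simp add: j_def qK_power_int power_nat_shift[OF _ qh_nonzero])
    finally show ?thesis by (simp add: algebra_simps)
  qed
  have 2: "Fract n 1 = qh ^ l * (tK - qK powi (m - 1))"
  proof -
    have "Fract n 1 = qh ^ l * tK - qh ^ i"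
      unfolding n_def F qh_th_monomial[symmetric] by simp
    also have "qh ^ i = qh ^ l * qK powi (m - 1)"
      using l by (simp add: i_def qK_power_int power_nat_shift[OF _ qh_nonzero] right_diff_distrib)
    finally show ?thesis by (simp add: algebra_simps)
  qed
  have d0: "d \<noteq> 0" and n0: "n \<noteq> 0"
    using 1 2 one_minus_tq_ne_0[of m] t_minus_q_ne_0[of "m - 1"] by (auto simp: Zero_fract_def[symmetric])
  have "Fract n d = Fract n 1 / Fract d 1" by simp
  also have "\<dots> = (tK - qK powi (m - 1)) / (1 - tK * qK powi m)"
    unfolding 1 2 by simp
  finally show thesis using that rec d0 n0 by blast
qed

text \<open>The ratio is \<open>1\<close> at \<open>0\<close>, and the recurrence carries it in both
  directions.\<close>

lemma mu_ratio_ex: "\<exists>r. mu_ratio (2 * m) r"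
proof (induction m rule: int_induct[where k = 0])
  case base
  then show ?case using mu_ratio_0 by auto
next
  case (step1 i)
  obtain d n where "ser_of_poly d * mu_coeff (2 * (i + 1)) = ser_of_poly n * mu_coeff (2 * (i + 1) - 2)"
    "d \<noteq> 0" using mu_coeff_recurrence_poly[of "i + 1"] by metis
  with step1 mu_ratio_step show ?case by (metis add_diff_cancel_right' distrib_left mult_numeral_1_right mult.right_neutral)
next
  case (step2 i)
  obtain d n where "ser_of_poly d * mu_coeff (2 * i) = ser_of_poly n * mu_coeff (2 * i - 2)"
    "n \<noteq> 0" using mu_coeff_recurrence_poly[of i] by metis
  with step2 mu_ratio_step show ?case by (metis right_diff_distrib mult.right_neutral)
qed

lemma mu0_0: "mu0 0 = 1"
  by (rule mu0_eqI[OF mu_ratio_0])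

lemma mu0_odd: "odd m \<Longrightarrow> mu0 m = 0"
  by (rule mu0_eqI[OF mu_ratio_odd])

text \<open>Together with \<open>mu0_0\<close> and \<open>mu0_odd\<close> this is all that is used
  of the weight from here on.\<close>

lemma mu0_recurrence:
  "(1 - tK * qK powi m) * mu0 (2 * m) = (tK - qK powi (m - 1)) * mu0 (2 * m - 2)"
proof -
  obtain r where "mu_ratio (2 * (m - 1)) r" using mu_ratio_ex by blast
  then have r: "mu_ratio (2 * m - 2) r" by (simp add: right_diff_distrib)
  obtain d n where dn: "ser_of_poly d * mu_coeff (2 * m) = ser_of_poly n * mu_coeff (2 * m - 2)"
    "d \<noteq> 0" "Fract n d = (tK - qK powi (m - 1)) / (1 - tK * qK powi m)"
    using mu_coeff_recurrence_poly[of m] by metis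
  have "mu0 (2 * m) = mu0 (2 * m - 2) * ((tK - qK powi (m - 1)) / (1 - tK * qK powi m))"
    using mu0_eqI[OF mu_ratio_step[OF r dn(2,1)]] mu0_eqI[OF r] dn(3) by simp
  then show ?thesis using one_minus_tq_ne_0[of m] by simp
qed

section \<open>Invariance of the weight under the bar\<close>

lemma K_bar_1 [simp]: "K_bar 1 = 1" and K_bar_0 [simp]: "K_bar 0 = 0"
  using K_bar_hom(3)[of 1] K_bar_hom(3)[of 0] by simp_all

lemma K_bar_diff: "K_bar (x - y) = K_bar x - K_bar y"
  using K_bar_hom(1)[of "x - y" y] by simp

lemma K_bar_power: "K_bar (x ^ n) = K_bar x ^ n"
  by (induction n) (simp_all add: K_bar_hom)

lemma K_bar_inverse: "K_bar (inverse x) = inverse (K_bar x)"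
proof (cases "x = 0")
  case False
  then have "K_bar x * K_bar (inverse x) = 1"
    by (simp flip: K_bar_hom(2))
  then show ?thesis by (metis inverse_unique)
qed simp

lemma K_bar_power_int: "K_bar (x powi m) = K_bar x powi m"
  by (simp add: power_int_def K_bar_power K_bar_inverse)

text \<open>Applying the bar to the recurrence at \<open>1 - i\<close> and multiplying by
  \<open>t\<close> gives the original recurrence for the barred, index-reversed coefficients. They
  agree at \<open>0\<close>, hence everywhere.\<close>

lemma K_bar_mu0: "K_bar (mu0 m) = mu0 (- m)"
proof (cases "even m")
  case False
  then show ?thesis by (simp add: mu0_odd)
next
  case True
  then obtain i where i: "- m = 2 * i" by (metis dvd_minus_iff evenE)
  have rec: "(1 - tK * qK powi i) * K_bar (mu0 (- 2 * i)) =
      (tK - qK powi (i - 1)) * K_bar (mu0 (- 2 * (i - 1)))" for i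
  proof -
    have "K_bar ((1 - tK * qK powi (1 - i)) * mu0 (2 * (1 - i))) =
        K_bar ((tK - qK powi (1 - i - 1)) * mu0 (2 * (1 - i) - 2))"
      by (simp only: mu0_recurrence)
    then have "(1 - inverse tK * inverse qK powi (1 - i)) * K_bar (mu0 (- 2 * (i - 1))) =
        (inverse tK - inverse qK powi (- i)) * K_bar (mu0 (- 2 * i))"
      by (simp add: K_bar_hom K_bar_diff K_bar_power K_bar_power_int power_inverse algebra_simps)
    moreover have "inverse qK powi (1 - i) = qK powi (i - 1)" "inverse qK powi (- i) = qK powi i"
      by (simp_all add: power_int_inverse flip: power_int_minus)
    ultimately have *: "(1 - inverse tK * qK powi (i - 1)) * K_bar (mu0 (- 2 * (i - 1))) =
        (inverse tK - qK powi i) * K_bar (mu0 (- 2 * i))" by simp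
    have "tK * ((1 - inverse tK * qK powi (i - 1)) * K_bar (mu0 (- 2 * (i - 1)))) =
        tK * ((inverse tK - qK powi i) * K_bar (mu0 (- 2 * i)))"
      by (simp only: *)
    then show ?thesis by (simp add: right_diff_distrib flip: mult.assoc)
  qed
  have "K_bar (mu0 (- 2 * i)) = mu0 (2 * i)"
  proof (induction i rule: int_induct[where k = 0])
    case base
    then show ?case by (simp add: mu0_0)
  next
    case (step1 i)
    have "(1 - tK * qK powi (i + 1)) * K_bar (mu0 (- 2 * (i + 1))) =
        (1 - tK * qK powi (i + 1)) * mu0 (2 * (i + 1))"
      using rec[of "i + 1"] mu0_recurrence[of "i + 1"] step1 by simp
    then show ?case using one_minus_tq_ne_0[of "i + 1"] by simp
  next
    case (step2 i)
    have "(tK - qK powi (i - 1)) * K_bar (mu0 (- 2 * (i - 1))) =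
        (tK - qK powi (i - 1)) * mu0 (2 * (i - 1))"
    proof -
      have "2 * (i - 1) = 2 * i - 2" by simp
      then show ?thesis
        using rec[of i] mu0_recurrence[of i] step2(2) by metis
    qed
    then show ?case using t_minus_q_ne_0[of "i - 1"] by simp
  qed
  moreover have "m = - 2 * i" using i by simp
  ultimately show ?thesis by simp
qed

section \<open>The Szego recursion\<close>

lemma CT_mu0_superset:
  assumes "finite N" "Poly_Mapping.keys f \<subseteq> N"
  shows "CT_mu0 f = (\<Sum>m\<in>N. Poly_Mapping.lookup f m * mu0 (- m))"
  unfolding CT_mu0_def
  by (rule sum.mono_neutral_left) (use assms in \<open>auto simp: in_keys_iff\<close>)

lemma CT_mu0_add: "CT_mu0 (f + g) = CT_mu0 f + CT_mu0 g"
proof -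
  let ?N = "Poly_Mapping.keys f \<union> Poly_Mapping.keys g"
  have "Poly_Mapping.keys (f + g) \<subseteq> ?N" by (rule keys_add)
  then show ?thesis
    by (simp add: CT_mu0_superset[of ?N] lookup_add distrib_right sum.distrib)
qed

lemma CT_mu0_0 [simp]: "CT_mu0 0 = 0"
  by (simp add: CT_mu0_def)

lemma CT_mu0_sum: "CT_mu0 (sum h A) = (\<Sum>a\<in>A. CT_mu0 (h a))"
  by (induction A rule: infinite_finite_induct) (simp_all add: CT_mu0_add)

lemma CT_mu0_single: "CT_mu0 (Poly_Mapping.single m c) = c * mu0 (- m)"
  by (subst CT_mu0_superset[of "{m}"]) auto

abbreviation L_const :: "K \<Rightarrow> laurent" where
  "L_const c \<equiv> Poly_Mapping.single 0 c"

lemma laurent_sum_single: "f = (\<Sum>n\<in>Poly_Mapping.keys f. Poly_Mapping.single n (Poly_Mapping.lookup f n))"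
  by (rule poly_mapping_sum_single) auto

lemma CT_mu0_scale: "CT_mu0 (L_const c * f) = c * CT_mu0 f"
proof -
  have "L_const c * f = (\<Sum>n\<in>Poly_Mapping.keys f. Poly_Mapping.single n (c * Poly_Mapping.lookup f n))"
    by (subst laurent_sum_single[of f]) (simp add: sum_distrib_left mult_single)
  then show ?thesis
    by (simp add: CT_mu0_sum CT_mu0_single CT_mu0_def[of f] sum_distrib_left mult.assoc)
qed

lemma CT_mu0_diff: "CT_mu0 (f - g) = CT_mu0 f - CT_mu0 g"
  using CT_mu0_add[of "f - g" g] by simp

text \<open>Reduces every pairing to moments by expanding the second factor.\<close>

lemma CT_mu0_mult_keys:
  "CT_mu0 (f * g) = (\<Sum>n\<in>Poly_Mapping.keys g. Poly_Mapping.lookup g n * CT_mu0 (f * X_pow n))"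
proof -
  have "f * g = (\<Sum>n\<in>Poly_Mapping.keys g. L_const (Poly_Mapping.lookup g n) * (f * X_pow n))"
    by (subst laurent_sum_single[of g])
       (simp add: sum_distrib_left mult.left_commute[of "L_const _"] mult_single)
  then show ?thesis by (simp add: CT_mu0_sum CT_mu0_scale)
qed

section \<open>Evaluation of Laurent polynomials\<close>

lemma L_eval_superset:
  assumes "finite N" "Poly_Mapping.keys f \<subseteq> N"
  shows "L_eval f x = (\<Sum>m\<in>N. Poly_Mapping.lookup f m * x powi m)"
  unfolding L_eval_def
  by (rule sum.mono_neutral_left) (use assms in \<open>auto simp: in_keys_iff\<close>)

lemma L_eval_add: "L_eval (f + g) x = L_eval f x + L_eval g x"
proof -
  let ?N = "Poly_Mapping.keys f \<union> Poly_Mapping.keys g"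
  have "Poly_Mapping.keys (f + g) \<subseteq> ?N" by (rule keys_add)
  then show ?thesis
    by (simp add: L_eval_superset[of ?N] lookup_add distrib_right sum.distrib)
qed

lemma L_eval_0 [simp]: "L_eval 0 x = 0"
  by (simp add: L_eval_def)

lemma L_eval_sum: "L_eval (sum h A) x = (\<Sum>a\<in>A. L_eval (h a) x)"
  by (induction A rule: infinite_finite_induct) (simp_all add: L_eval_add)

lemma L_eval_single: "L_eval (Poly_Mapping.single m c) x = c * x powi m"
  by (subst L_eval_superset[of "{m}"]) auto

lemma L_eval_single_mult:
  assumes "x \<noteq> 0"
  shows "L_eval (Poly_Mapping.single m c * f) x = c * x powi m * L_eval f x"
proof -
  have "Poly_Mapping.single m c * f =
      (\<Sum>n\<in>Poly_Mapping.keys f. Poly_Mapping.single (m + n) (c * Poly_Mapping.lookup f n))"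
    by (subst laurent_sum_single[of f]) (simp add: sum_distrib_left mult_single)
  then show ?thesis
    using assms
    by (simp add: L_eval_sum L_eval_single L_eval_def[of f] sum_distrib_left power_int_add mult_ac)
qed

text \<open>
  In the variable \<open>X\<^sup>2\<close> the functional \<^const>\<open>CT_mu0\<close> is a linear functional on the unit circle, and
  \<open>szego_coeff\<close> are its Verblunsky coefficients up to powers of \<open>q\<close>. It turns out that
  \<open>szego_P k\<close> is \<open>e\<^sub>k\<^sub>+\<^sub>1\<close> and \<open>szego_R k\<close> is its bar conjugate.
\<close>

definition szego_coeff :: "nat \<Rightarrow> K" where
  "szego_coeff n = (1 - tK) / (1 - tK * qK ^ n)"

fun szego_P :: "nat \<Rightarrow> laurent" and szego_R :: "nat \<Rightarrow> laurent" where
  "szego_P 0 = X_pow 1"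
| "szego_R 0 = X_pow (-1)"
| "szego_P (Suc k) = X_pow 1 * (szego_P k + L_const (qK ^ Suc k * szego_coeff (Suc k)) * szego_R k)"
| "szego_R (Suc k) = X_pow (-1) * (szego_R k + L_const (szego_coeff (Suc k)) * szego_P k)"

lemma szego_lookup_eq_0:
  "(m < 1 - int k \<or> m > int k + 1 \<longrightarrow> Poly_Mapping.lookup (szego_P k) m = 0) \<and>
   (m < - int k - 1 \<or> m > int k - 1 \<longrightarrow> Poly_Mapping.lookup (szego_R k) m = 0)"
  by (induction k arbitrary: m)
     (auto simp: lookup_single_mult lookup_add lookup_single when_def simp del: power_Suc)

lemma szego_lookup_top:
  "Poly_Mapping.lookup (szego_P k) (int k + 1) = 1 \<and>
   Poly_Mapping.lookup (szego_R k) (- int k - 1) = 1"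
proof (induction k)
  case (Suc k)
  have "Poly_Mapping.lookup (szego_R k) (int k + 1) = 0" "Poly_Mapping.lookup (szego_P k) (- int k - 1) = 0"
    using szego_lookup_eq_0[of "int k + 1" k] szego_lookup_eq_0[of "- int k - 1" k] by auto
  moreover have "int (Suc k) + 1 - 1 = int k + 1" "- int (Suc k) - 1 - - 1 = - int k - 1" by simp_all
  ultimately show ?case
    using Suc by (simp only: szego_P.simps szego_R.simps lookup_single_mult lookup_add) simp
qed (simp_all add: lookup_single)

section \<open>Closed form of the moments\<close>

definition szego_kappa :: "nat \<Rightarrow> K" where
  "szego_kappa k = (\<Prod>i=1..k. (1 - tK ^ 2 * qK ^ i) / (1 - tK * qK ^ i))"

text \<open>\<open>szego_moments\<close> identifies this as a moment of \<open>szego_P k\<close>.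
  Its numerators vanish exactly for \<open>m = 1, ..., k\<close>, which will be
  orthogonality.\<close>

definition szego_moment :: "nat \<Rightarrow> int \<Rightarrow> K" where
  "szego_moment k m = szego_kappa k * mu0 (2 * (m - int k - 1)) *
     (\<Prod>i=1..k. (1 - qK powi (m - int i)) / (1 - tK * qK powi (m - int i)))"

lemma szego_moment_Suc_1:
  "szego_moment (Suc k) (m + 1) = szego_moment k m *
     ((1 - qK powi m) / (1 - tK * qK powi m)) * ((1 - tK ^ 2 * qK ^ Suc k) / (1 - tK * qK ^ Suc k))"
proof -
  have "(\<Prod>i=1..Suc k. (1 - qK powi (m + 1 - int i)) / (1 - tK * qK powi (m + 1 - int i))) =
      ((1 - qK powi m) / (1 - tK * qK powi m)) *
      (\<Prod>i=1..k. (1 - qK powi (m - int i)) / (1 - tK * qK powi (m - int i)))"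
    by (subst prod.atLeast_Suc_atMost) (simp_all del: prod.cl_ivl_Suc add: prod.shift_bounds_cl_Suc_ivl)
  moreover have "m + 1 - int (Suc k) - 1 = m - int k - 1" by simp
  ultimately show ?thesis
    by (simp add: szego_moment_def szego_kappa_def mult_ac del: power_Suc)
qed

text \<open>At fixed \<open>m\<close> the new factor is the last one, and the recurrence for
  \<open>mu0\<close> cancels its denominator.\<close>

lemma szego_moment_Suc_2:
  "szego_moment (Suc k) m * ((tK - qK powi (m - int k - 2)) / (1 - tK * qK powi m)) =
     szego_moment k m * ((1 - qK powi (m - int k - 1)) / (1 - tK * qK powi m)) *
     ((1 - tK ^ 2 * qK ^ Suc k) / (1 - tK * qK ^ Suc k))"
proof -
  let ?p = "\<Prod>i=1..k. (1 - qK powi (m - int i)) / (1 - tK * qK powi (m - int i))"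
  let ?a = "tK - qK powi (m - int k - 2)" and ?b = "1 - tK * qK powi (m - int k - 1)"
  have e: "m - int k - 1 - 1 = m - int k - 2" "2 * (m - int k - 1) - 2 = 2 * (m - int k - 2)" by simp_all
  have rec: "?b * mu0 (2 * (m - int k - 1)) = ?a * mu0 (2 * (m - int k - 2))"
    using mu0_recurrence[of "m - int k - 1"] unfolding e .
  have u: "mu0 (2 * (m - int k - 2)) * ?a / ?b = mu0 (2 * (m - int k - 1))"
    using rec one_minus_tq_ne_0[of "m - int k - 1"] by (simp add: field_simps)
  have 1: "szego_moment (Suc k) m = szego_kappa (Suc k) * mu0 (2 * (m - int k - 2)) *
      (?p * ((1 - qK powi (m - int k - 1)) / ?b))"
    by (simp add: szego_moment_def algebra_simps)
  have 2: "szego_kappa (Suc k) = szego_kappa k * ((1 - tK ^ 2 * qK ^ Suc k) / (1 - tK * qK ^ Suc k))"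
    by (simp add: szego_kappa_def)
  show ?thesis
    unfolding 1 2 unfolding szego_moment_def u[symmetric] by (simp only: times_divide_eq_left times_divide_eq_right divide_divide_eq_left mult_ac)
qed

text \<open>Applied with \<open>g\<close> the moment at stage \<open>k\<close>,
  \<open>b = q^(k+1)\<close> and \<open>a = q^(m-k-1)\<close>, so that \<open>a * b = q^m\<close>;
  likewise in \<open>szego_step_R\<close>.\<close>

lemma szego_step_P:
  fixes a b t g :: "'a :: field"
  assumes "1 - t * b \<noteq> 0" "1 - t * (a * b) \<noteq> 0"
  shows "g + b * ((1 - t) / (1 - t * b)) * (g * ((t - a) / (1 - t * (a * b)))) =
    g * ((1 - a * b) / (1 - t * (a * b))) * ((1 - t ^ 2 * b) / (1 - t * b))"
  using assms by (simp add: divide_simps) algebra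

lemma szego_step_R:
  fixes a b t g :: "'a :: field"
  assumes "1 - t * b \<noteq> 0" "1 - t * (a * b) \<noteq> 0"
  shows "g * ((t - a) / (1 - t * (a * b))) + (1 - t) / (1 - t * b) * g =
    g * ((1 - a) / (1 - t * (a * b))) * ((1 - t ^ 2 * b) / (1 - t * b))"
  using assms by (simp add: divide_simps) algebra

lemma szego_step_eval:
  fixes b t :: "'a :: field"
  assumes "1 - t * b \<noteq> 0"
  shows "1 + (b * ((1 - t) / (1 - t * b))) * t = (1 - t ^ 2 * b) / (1 - t * b)"
    and "t + (1 - t) / (1 - t * b) = (1 - t ^ 2 * b) / (1 - t * b)"
  using assms by (simp add: divide_simps, algebra)+

text \<open>The recursion mixes the two families, so both moments are computed in one induction;
  their quotient is the explicit factor in the second formula. The base case is the recurrence for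
  \<open>mu0\<close>.\<close>

lemma szego_moments:
  "CT_mu0 (szego_P k * X_pow (int k + 1 - 2 * m)) = szego_moment k m \<and>
   CT_mu0 (szego_R k * X_pow (int k + 1 - 2 * m)) =
     szego_moment k m * ((tK - qK powi (m - int k - 1)) / (1 - tK * qK powi m))"
proof (induction k arbitrary: m)
  case 0
  have "(1 - tK * qK powi m) * mu0 (2 * m) = (tK - qK powi (m - 1)) * mu0 (2 * (m - 1))"
    using mu0_recurrence[of m] by (simp add: right_diff_distrib)
  then have "mu0 (2 * m) = mu0 (2 * (m - 1)) * ((tK - qK powi (m - 1)) / (1 - tK * qK powi m))"
    using one_minus_tq_ne_0[of m] by (simp add: field_simps)
  moreover have "szego_moment 0 m = mu0 (2 * (m - 1))"
    by (simp add: szego_moment_def szego_kappa_def)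
  ultimately show ?case by (simp add: mult_single CT_mu0_single)
next
  case (Suc k)
  have Xa: "X_pow a * (p * X_pow b) = p * (X_pow (a + b) :: laurent)" for a b p
    by (simp add: mult.left_commute mult_single)
  have q1: "qK powi m = qK powi (m - int k - 1) * qK ^ Suc k" for m
  proof -
    have "qK powi ((m - int k - 1) + int (Suc k)) = qK powi (m - int k - 1) * qK powi int (Suc k)"
      by (rule power_int_add) simp
    then show ?thesis by (simp only: power_int_of_nat) simp
  qed
  have nz: "1 - tK * qK ^ Suc k \<noteq> 0" "1 - tK * (qK powi (m - int k - 1) * qK ^ Suc k) \<noteq> 0" for m
    using one_minus_tq_ne_0[of "int (Suc k)"] one_minus_tq_ne_0[of m]
    unfolding q1[symmetric] by (simp_all only: power_int_of_nat not_False_eq_True)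
  \<comment> \<open>Multiplication by \<open>X\<close> shifts the index, so the moment of
    \<open>szego_P\<close> is found at \<open>m + 1\<close> and used at
    \<open>m - 1\<close>.\<close>
  have P: "CT_mu0 (szego_P (Suc k) * X_pow (int (Suc k) + 1 - 2 * (m + 1))) = szego_moment (Suc k) (m + 1)" for m
  proof -
    have "szego_P (Suc k) * X_pow (int (Suc k) + 1 - 2 * (m + 1)) =
        szego_P k * X_pow (int k + 1 - 2 * m) +
        L_const (qK ^ Suc k * szego_coeff (Suc k)) * (szego_R k * X_pow (int k + 1 - 2 * m))"
      by (simp add: distrib_right distrib_left mult.assoc Xa mult.left_commute[of "X_pow 1"] del: power_Suc)
         (simp add: algebra_simps del: power_Suc)
    then have "CT_mu0 (szego_P (Suc k) * X_pow (int (Suc k) + 1 - 2 * (m + 1))) =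
        szego_moment k m + qK ^ Suc k * ((1 - tK) / (1 - tK * qK ^ Suc k)) *
        (szego_moment k m * ((tK - qK powi (m - int k - 1)) / (1 - tK * qK powi m)))"
      using Suc[of m] by (simp only: CT_mu0_add CT_mu0_scale szego_coeff_def)
    also have "\<dots> = szego_moment (Suc k) (m + 1)"
      unfolding szego_moment_Suc_1 unfolding q1[of m] by (rule szego_step_P[OF nz])
    finally show ?thesis .
  qed
  have R: "CT_mu0 (szego_R (Suc k) * X_pow (int (Suc k) + 1 - 2 * m)) =
     szego_moment (Suc k) m * ((tK - qK powi (m - int k - 2)) / (1 - tK * qK powi m))"
  proof -
    have "szego_R (Suc k) * X_pow (int (Suc k) + 1 - 2 * m) =
        szego_R k * X_pow (int k + 1 - 2 * m) +
        L_const (szego_coeff (Suc k)) * (szego_P k * X_pow (int k + 1 - 2 * m))"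
      by (simp add: distrib_right distrib_left mult.assoc Xa mult.left_commute[of "X_pow (-1)"] del: power_Suc)
         (simp add: algebra_simps del: power_Suc)
    then have "CT_mu0 (szego_R (Suc k) * X_pow (int (Suc k) + 1 - 2 * m)) =
        szego_moment k m * ((tK - qK powi (m - int k - 1)) / (1 - tK * qK powi m)) +
        (1 - tK) / (1 - tK * qK ^ Suc k) * szego_moment k m"
      using Suc[of m] by (simp only: CT_mu0_add CT_mu0_scale szego_coeff_def)
    also have "\<dots> = szego_moment (Suc k) m * ((tK - qK powi (m - int k - 2)) / (1 - tK * qK powi m))"
      unfolding szego_moment_Suc_2 unfolding q1[of m] by (rule szego_step_R[OF nz])
    finally show ?thesis .
  qed
  have "m - int (Suc k) - 1 = m - int k - 2" by simp
  then show ?case using P[of "m - 1"] R by simp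
qed

text \<open>The moments of the other parity: each step of the recursion moves the exponent by one,
  and \<open>mu0\<close> vanishes at odd exponents.\<close>

lemma szego_moment_parity:
  "even (int k + j) \<Longrightarrow>
   CT_mu0 (szego_P k * X_pow j) = 0 \<and> CT_mu0 (szego_R k * X_pow j) = 0"
proof (induction k arbitrary: j)
  case 0
  then show ?case by (simp add: mult_single CT_mu0_single mu0_odd)
next
  case (Suc k)
  have P: "szego_P (Suc k) * X_pow j = szego_P k * X_pow (j + 1) +
      L_const (qK ^ Suc k * szego_coeff (Suc k)) * (szego_R k * X_pow (j + 1))"
  proof -
    have "X_pow (j + 1) = (X_pow 1 * X_pow j :: laurent)" by (simp add: mult_single add.commute)
    then show ?thesis by (simp add: distrib_left mult_ac del: power_Suc)
  qed
  have R: "szego_R (Suc k) * X_pow j = szego_R k * X_pow (j - 1) +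
      L_const (szego_coeff (Suc k)) * (szego_P k * X_pow (j - 1))"
  proof -
    have "X_pow (j - 1) = (X_pow (-1) * X_pow j :: laurent)" by (simp add: mult_single add.commute)
    then show ?thesis by (simp add: distrib_left mult_ac del: power_Suc)
  qed
  have "even (int k + (j + 1))" "even (int k + (j - 1))" using Suc.prems by auto
  then show ?case
    unfolding P R CT_mu0_add CT_mu0_scale using Suc.IH[of "j + 1"] Suc.IH[of "j - 1"] by simp
qed

lemma szego_orthogonal:
  assumes "\<bar>j\<bar> \<le> int k"
  shows "CT_mu0 (szego_P k * X_pow j) = 0" "CT_mu0 (szego_R k * X_pow j) = 0"
proof -
  have "CT_mu0 (szego_P k * X_pow j) = 0 \<and> CT_mu0 (szego_R k * X_pow j) = 0"
  proof (cases "even (int k + j)")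
    case True
    then show ?thesis by (rule szego_moment_parity)
  next
    case False
    then have "even (int k + 1 - j)" by auto
    then obtain m where m: "int k + 1 - j = 2 * m" by blast
    then have j: "j = int k + 1 - 2 * m" by simp
    \<comment> \<open>The bound on \<open>j\<close> places \<open>m\<close> among the indices of the
      product, whose factor there is \<open>1 - q^0 = 0\<close>.\<close>
    have "nat m \<in> {1..k}" "int (nat m) = m" using assms m False by auto
    then have "szego_moment k m = 0"
      unfolding szego_moment_def by (auto intro!: prod_zero bexI[of _ "nat m"])
    then show ?thesis using szego_moments[of k m] unfolding j by simp
  qed
  then show "CT_mu0 (szego_P k * X_pow j) = 0" "CT_mu0 (szego_R k * X_pow j) = 0" by auto
qed

definition szego_norm :: "nat \<Rightarrow> K" where
  "szego_norm k = szego_kappa k * (\<Prod>i=1..k. (1 - qK ^ i) / (1 - tK * qK ^ i))"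

text \<open>The moment at \<open>m = k + 1\<close>, where \<open>mu0 0 = 1\<close> enters; the
  product is then read backwards.\<close>

lemma szego_P_norm: "CT_mu0 (szego_P k * X_pow (- int k - 1)) = szego_norm k"
proof -
  have "(\<Prod>i=1..k. (1 - qK powi (int k + 1 - int i)) / (1 - tK * qK powi (int k + 1 - int i))) =
      (\<Prod>i=1..k. (1 - qK ^ i) / (1 - tK * qK ^ i))"
  proof (rule prod.reindex_bij_witness[where i = "\<lambda>i. k + 1 - i" and j = "\<lambda>i. k + 1 - i"])
    fix i assume i: "i \<in> {1..k}"
    then have "int k + 1 - int i = int (k + 1 - i)" by auto
    then show "(1 - qK ^ (k + 1 - i)) / (1 - tK * qK ^ (k + 1 - i)) =
        (1 - qK powi (int k + 1 - int i)) / (1 - tK * qK powi (int k + 1 - int i))"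
      by (simp only: power_int_of_nat)
  qed auto
  then show ?thesis
    using szego_moments[of k "int k + 1"] by (simp add: szego_moment_def szego_norm_def mu0_0)
qed

text \<open>Of the exponents in \<open>szego_R k\<close> only \<open>- k - 1\<close> escapes
  orthogonality to \<open>szego_P k\<close>, and its coefficient is \<open>1\<close>.\<close>

lemma szego_PR_norm: "CT_mu0 (szego_P k * szego_R k) = szego_norm k"
proof -
  let ?R = "szego_R k" and ?c = "- int k - 1"
  have "CT_mu0 (szego_P k * ?R) = (\<Sum>n\<in>Poly_Mapping.keys ?R. if n = ?c then szego_norm k else 0)"
  proof (subst CT_mu0_mult_keys, rule sum.cong[OF refl])
    fix n assume n: "n \<in> Poly_Mapping.keys ?R"
    then have "Poly_Mapping.lookup ?R n \<noteq> 0" by (simp add: in_keys_iff)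
    then have "- int k - 1 \<le> n" "n \<le> int k - 1"
      using szego_lookup_eq_0[of n k] by linarith+
    then have "n = ?c \<or> \<bar>n\<bar> \<le> int k" by linarith
    then show "Poly_Mapping.lookup ?R n * CT_mu0 (szego_P k * X_pow n) = (if n = ?c then szego_norm k else 0)"
      using szego_orthogonal(1)[of n k] szego_lookup_top[of k] szego_P_norm[of k] by (cases "n = ?c") simp_all
  qed
  also have "\<dots> = szego_norm k"
    using szego_lookup_top[of k] by (simp add: in_keys_iff)
  finally show ?thesis .
qed

lemma szego_kappa_ne_0: "szego_kappa k \<noteq> 0"
  unfolding szego_kappa_def using one_minus_t2q_ne_0[of "int _"] one_minus_tq_ne_0[of "int _"] by auto

lemma szego_norm_ne_0: "szego_norm k \<noteq> 0"
  unfolding szego_norm_def using szego_kappa_ne_0 one_minus_q_ne_0[of "int _"] one_minus_tq_ne_0[of "int _"]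
  by auto

text \<open>At \<open>X = inverse th\<close> the value of \<open>szego_R k\<close> stays
  \<open>t\<close> times that of \<open>szego_P k\<close>. Both recursion brackets then give the
  same factor of \<open>szego_kappa\<close>, which also occurs in the moments.\<close>

lemma szego_eval:
  "L_eval (szego_P k) (inverse th) = inverse th ^ Suc k * szego_kappa k \<and>
   L_eval (szego_R k) (inverse th) = tK * (inverse th ^ Suc k * szego_kappa k)"
proof (induction k)
  case 0
  then show ?case by (simp add: L_eval_single szego_kappa_def power2_eq_square)
next
  case (Suc k)
  let ?E = "inverse th ^ Suc k * szego_kappa k" and ?b = "qK ^ Suc k"
  have nz: "1 - tK * ?b \<noteq> 0" using one_minus_tq_ne_0[of "int (Suc k)"] by (simp only: power_int_of_nat not_False_eq_True)
  have kap: "szego_kappa (Suc k) = szego_kappa k * ((1 - tK ^ 2 * ?b) / (1 - tK * ?b))"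
    by (simp add: szego_kappa_def)
  have P: "1 + (?b * szego_coeff (Suc k)) * tK = (1 - tK ^ 2 * ?b) / (1 - tK * ?b)"
    unfolding szego_coeff_def by (rule szego_step_eval(1)[OF nz])
  have R: "tK + szego_coeff (Suc k) = (1 - tK ^ 2 * ?b) / (1 - tK * ?b)"
    unfolding szego_coeff_def by (rule szego_step_eval(2)[OF nz])
  have "L_eval (szego_P (Suc k)) (inverse th) = inverse th * (?E * (1 + (?b * szego_coeff (Suc k)) * tK))"
    using Suc by (simp add: L_eval_single_mult L_eval_add del: power_Suc) (simp add: algebra_simps del: power_Suc)
  moreover have "L_eval (szego_R (Suc k)) (inverse th) = th * (?E * (tK + szego_coeff (Suc k)))"
    using Suc by (simp add: L_eval_single_mult L_eval_add power_int_minus del: power_Suc) (simp add: algebra_simps del: power_Suc)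
  ultimately show ?case
    unfolding P R kap by (simp add: power2_eq_square)
qed

section \<open>Nonsymmetric polynomials and their dual basis\<close>

text \<open>\<open>dual_poly n\<close> is the multiple of \<open>T \<epsilon>\<^sub>n\<close> with coefficient \<open>1\<close> at \<open>X\<^sup>-\<^sup>n\<close>.\<close>

definition ns_poly :: "int \<Rightarrow> laurent" where
  "ns_poly n = (if n > 0 then szego_P (nat (n - 1)) else X_pow 1 * szego_R (nat (- n)))"

definition dual_poly :: "int \<Rightarrow> laurent" where
  "dual_poly n = (if n > 0 then szego_R (nat (n - 1)) else X_pow (-1) * szego_P (nat (- n)))"

text \<open>Equal for \<open>n\<close> and \<open>1 - n\<close>, the same pairing as for the values
  of \<open>mu1\<close>.\<close>

definition szego_index :: "int \<Rightarrow> nat" where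
  "szego_index n = nat (if n > 0 then n - 1 else - n)"

lemma szego_index_simps [simp]:
  "ns_poly (int k + 1) = szego_P k" "ns_poly (- int k) = X_pow 1 * szego_R k"
  "dual_poly (int k + 1) = szego_R k" "dual_poly (- int k) = X_pow (-1) * szego_P k"
  "szego_index (int k + 1) = k" "szego_index (- int k) = k"
  by (simp_all add: ns_poly_def dual_poly_def szego_index_def)

section \<open>The monomial order as a ranking\<close>

lemma int_sign_cases:
  obtains (pos) k where "n = int k + 1" | (nonpos) k where "n = - int k"
proof (cases "n > 0")
  case True
  then have "n = int (nat (n - 1)) + 1" by simp
  then show thesis by (rule pos)
next
  case False
  then have "n = - int (nat (- n))" by simp
  then show thesis by (rule nonpos)
qed

text \<open>Position in the enumeration \<open>0, 1, -1, 2, -2, ...\<close>.\<close>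

definition prec_rank :: "int \<Rightarrow> nat" where
  "prec_rank n = nat (if n > 0 then 2 * n - 1 else - 2 * n)"

lemma prec_rank_simps [simp]:
  "prec_rank (int k + 1) = 2 * k + 1" "prec_rank (- int k) = 2 * k"
  by (simp_all add: prec_rank_def)

lemma prec_iff_rank: "prec m n \<longleftrightarrow> prec_rank m < prec_rank n"
  unfolding prec_def prec_rank_def by auto

lemma prec_rank_inj: "prec_rank m = prec_rank n \<longleftrightarrow> m = n"
  unfolding prec_rank_def by (auto split: if_splits simp: eq_nat_nat_iff) presburger+

lemma finite_prec_rank: "finite {n. prec_rank n \<le> M}"
proof (rule finite_subset)
  show "{n. prec_rank n \<le> M} \<subseteq> {- int M..int M}"
    by (auto simp: prec_rank_def split: if_splits)
qed simp

lemma prec_rank_leI: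
  "- int k \<le> m \<Longrightarrow> m \<le> int k \<Longrightarrow> prec_rank m \<le> 2 * k"
  "- int k \<le> m \<Longrightarrow> m \<le> int k + 1 \<Longrightarrow> prec_rank m \<le> 2 * k + 1"
  by (auto simp: prec_rank_def)

lemma prec_rank_lessD:
  "prec_rank m < 2 * k \<Longrightarrow> 1 - int k \<le> m \<and> m \<le> int k"
  "prec_rank m < 2 * k + 1 \<Longrightarrow> - int k \<le> m \<and> m \<le> int k"
  by (auto simp: prec_rank_def split: if_splits)

section \<open>Triangularity and biorthogonality of the two families\<close>

lemma szego_lookup_range:
  "Poly_Mapping.lookup (szego_P k) m \<noteq> 0 \<Longrightarrow> 1 - int k \<le> m \<and> m \<le> int k + 1"
  "Poly_Mapping.lookup (szego_R k) m \<noteq> 0 \<Longrightarrow> - int k - 1 \<le> m \<and> m \<le> int k - 1"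
  using szego_lookup_eq_0[of m k] by linarith+

lemma ns_poly_support:
  assumes "Poly_Mapping.lookup (ns_poly n) m \<noteq> 0"
  shows "prec_rank m \<le> prec_rank n"
proof (cases n rule: int_sign_cases)
  case (pos k)
  then have "1 - int k \<le> m \<and> m \<le> int k + 1" using assms szego_lookup_range(1)[of k m] by simp
  then show ?thesis using prec_rank_leI(2)[of k m] pos by simp
next
  case (nonpos k)
  then have "- int k - 1 \<le> m - 1 \<and> m - 1 \<le> int k - 1"
    using assms szego_lookup_range(2)[of k "m - 1"] by (simp add: lookup_single_mult)
  then show ?thesis using prec_rank_leI(1)[of k m] nonpos by simp
qed

lemma dual_poly_support:
  assumes "Poly_Mapping.lookup (dual_poly n) m \<noteq> 0"
  shows "prec_rank (- m) \<le> prec_rank n"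
proof (cases n rule: int_sign_cases)
  case (pos k)
  then have "- int k - 1 \<le> m \<and> m \<le> int k - 1" using assms szego_lookup_range(2)[of k m] by simp
  then show ?thesis using prec_rank_leI(2)[of k "- m"] pos by simp
next
  case (nonpos k)
  then have "1 - int k \<le> m + 1 \<and> m + 1 \<le> int k + 1"
    using assms szego_lookup_range(1)[of k "m + 1"] by (simp add: lookup_single_mult)
  then show ?thesis using prec_rank_leI(1)[of k "- m"] nonpos by simp
qed

lemma ns_poly_lead: "Poly_Mapping.lookup (ns_poly n) n = 1"
  by (cases n rule: int_sign_cases) (use szego_lookup_top in \<open>simp_all add: lookup_single_mult\<close>)

lemma dual_poly_lead: "Poly_Mapping.lookup (dual_poly n) (- n) = 1"
proof (cases n rule: int_sign_cases)
  case (pos k)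
  moreover have "- (int k + 1) = - int k - 1" by simp
  ultimately show ?thesis using szego_lookup_top[of k] by (simp only: szego_index_simps)
qed (use szego_lookup_top in \<open>simp_all add: lookup_single_mult\<close>)

lemma ns_poly_orthogonal:
  assumes "prec_rank j < prec_rank n"
  shows "CT_mu0 (ns_poly n * X_pow (- j)) = 0"
proof (cases n rule: int_sign_cases)
  case (pos k)
  then show ?thesis using assms prec_rank_lessD(2)[of j k] by (auto intro!: szego_orthogonal)
next
  case (nonpos k)
  have "X_pow 1 * szego_R k * X_pow (- j) = szego_R k * X_pow (1 - j)"
    by (simp add: mult.assoc mult.left_commute[of "X_pow 1"] mult_single)
  then show ?thesis
    using nonpos assms prec_rank_lessD(1)[of j k] by (simp only: szego_index_simps prec_rank_simps) (intro szego_orthogonal, auto)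
qed

lemma dual_poly_orthogonal:
  assumes "prec_rank j < prec_rank n"
  shows "CT_mu0 (dual_poly n * X_pow j) = 0"
proof (cases n rule: int_sign_cases)
  case (pos k)
  then show ?thesis using assms prec_rank_lessD(2)[of j k] by (auto intro!: szego_orthogonal)
next
  case (nonpos k)
  have "X_pow (-1) * szego_P k * X_pow j = szego_P k * X_pow (j - 1)"
    by (simp add: mult.assoc mult.left_commute[of "X_pow (-1)"] mult_single)
  then show ?thesis
    using nonpos assms prec_rank_lessD(1)[of j k] by (simp only: szego_index_simps prec_rank_simps) (intro szego_orthogonal, auto)
qed

text \<open>Off the diagonal, the polynomial of smaller rank is expanded and the other one is
  orthogonal to its monomials. On the diagonal the factors \<open>X\<close> and \<open>X^-1\<close>
  cancel.\<close>

lemma ns_dual_pairing: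
  "CT_mu0 (ns_poly m * dual_poly n) = (if m = n then szego_norm (szego_index n) else 0)"
proof -
  consider "m = n" | "prec_rank n < prec_rank m" | "prec_rank m < prec_rank n"
    using prec_rank_inj[of m n] by linarith
  then show ?thesis
  proof cases
    case 1
    have "X_pow 1 * a * (X_pow (-1) * b) = (X_pow 1 * X_pow (-1)) * (b * a)" for a b :: laurent
      by (simp only: mult_ac)
    then have X: "X_pow 1 * a * (X_pow (-1) * b) = b * a" for a b :: laurent
      by (simp add: mult_single)
    from 1 show ?thesis
      by (cases n rule: int_sign_cases) (simp_all add: szego_PR_norm X)
  next
    case 2
    have z: "Poly_Mapping.lookup (dual_poly n) i * CT_mu0 (ns_poly m * X_pow i) = 0" for i
      using dual_poly_support[of n i] ns_poly_orthogonal[of "- i" m] 2 by force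
    then have "CT_mu0 (ns_poly m * dual_poly n) = 0"
      by (subst CT_mu0_mult_keys) (simp only: z sum.neutral_const)
    with 2 show ?thesis by auto
  next
    case 3
    have z: "Poly_Mapping.lookup (ns_poly m) i * CT_mu0 (dual_poly n * X_pow i) = 0" for i
      using ns_poly_support[of m i] dual_poly_orthogonal[of i n] 3 by force
    then have "CT_mu0 (dual_poly n * ns_poly m) = 0"
      by (subst CT_mu0_mult_keys) (simp only: z sum.neutral_const)
    with 3 show ?thesis by (auto simp: mult.commute)
  qed
qed

text \<open>\<open>X^n\<close> may be replaced by \<open>ns_poly n\<close>, since its lower
  monomials are orthogonal to \<open>dual_poly n\<close>.\<close>

lemma monom_dual_pairing: "CT_mu0 (dual_poly n * X_pow n) = szego_norm (szego_index n)"
proof -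
  have "Poly_Mapping.lookup (ns_poly n) i * CT_mu0 (dual_poly n * X_pow i) =
      (if i = n then CT_mu0 (dual_poly n * X_pow n) else 0)" for i
  proof (cases "i = n")
    case False
    then show ?thesis
      using ns_poly_support[of n i] dual_poly_orthogonal[of i n] prec_rank_inj[of i n] by force
  qed (simp add: ns_poly_lead)
  then have "CT_mu0 (dual_poly n * ns_poly n) =
      (\<Sum>i\<in>Poly_Mapping.keys (ns_poly n). if i = n then CT_mu0 (dual_poly n * X_pow n) else 0)"
    by (subst CT_mu0_mult_keys) (simp only:)
  also have "\<dots> = CT_mu0 (dual_poly n * X_pow n)"
    using ns_poly_lead[of n] by (simp add: in_keys_iff)
  finally show ?thesis using ns_dual_pairing[of n n] by (simp add: mult.commute)
qed

text \<open>If \<open>X\<^sup>j\<close> is the leading monomial of a nonzero \<open>d\<close>, pairing with \<open>dual_poly j\<close> isolates its coefficient.\<close>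

lemma orthogonal_lower_eq_0:
  assumes supp: "\<And>m. Poly_Mapping.lookup d m \<noteq> 0 \<Longrightarrow> prec_rank m < M"
    and orth: "\<And>m. prec_rank m < M \<Longrightarrow> CT_mu0 (d * X_pow (- m)) = 0"
  shows "d = 0"
proof (rule ccontr)
  assume "d \<noteq> 0"
  then have ne: "Poly_Mapping.keys d \<noteq> {}" by (metis keys_eq_empty)
  define R where "R = Max (prec_rank ` Poly_Mapping.keys d)"
  have "R \<in> prec_rank ` Poly_Mapping.keys d" unfolding R_def using ne by (intro Max_in) auto
  then obtain j where j: "j \<in> Poly_Mapping.keys d" "R = prec_rank j" by blast
  have max: "prec_rank i \<le> prec_rank j" if "i \<in> Poly_Mapping.keys d" for i
    unfolding j(2)[symmetric] R_def using that by (intro Max_ge) auto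
  have jM: "prec_rank j < M" using supp j by (simp add: in_keys_iff)
  have z: "Poly_Mapping.lookup (dual_poly j) i * CT_mu0 (d * X_pow i) = 0" for i
    using dual_poly_support[of j i] orth[of "- i"] jM by force
  then have "CT_mu0 (d * dual_poly j) = 0" by (subst CT_mu0_mult_keys) (simp only: z sum.neutral_const)
  moreover have "CT_mu0 (dual_poly j * d) =
      (\<Sum>i\<in>Poly_Mapping.keys d. if i = j then Poly_Mapping.lookup d j * szego_norm (szego_index j) else 0)"
  proof (subst CT_mu0_mult_keys, rule sum.cong[OF refl])
    fix i assume i: "i \<in> Poly_Mapping.keys d"
    show "Poly_Mapping.lookup d i * CT_mu0 (dual_poly j * X_pow i) =
        (if i = j then Poly_Mapping.lookup d j * szego_norm (szego_index j) else 0)"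
    proof (cases "i = j")
      case False
      then have "prec_rank i < prec_rank j" using max[OF i] prec_rank_inj[of i j] by linarith
      then show ?thesis using dual_poly_orthogonal False by simp
    qed (simp add: monom_dual_pairing)
  qed
  ultimately have "Poly_Mapping.lookup d j * szego_norm (szego_index j) = 0"
    using j(1) by (simp add: mult.commute)
  then show False using szego_norm_ne_0 j(1) by (simp add: in_keys_iff)
qed

text \<open>For uniqueness, the difference of two solutions is supported strictly below
  \<open>n\<close> and orthogonal to all monomials there, hence zero.\<close>

lemma e_poly_eq: "e_poly n = ns_poly n"
  unfolding e_poly_def
proof (rule the_equality)
  show "Poly_Mapping.lookup (ns_poly n) n = 1 \<and>
      (\<forall>m\<in>Poly_Mapping.keys (ns_poly n). m = n \<or> prec m n) \<and>
      (\<forall>m. prec m n \<longrightarrow> CT_mu0 (ns_poly n * X_pow (- m)) = 0)"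
  proof (intro conjI ballI allI impI)
    fix m assume "m \<in> Poly_Mapping.keys (ns_poly n)"
    then have "prec_rank m \<le> prec_rank n" by (intro ns_poly_support) (simp add: in_keys_iff)
    then show "m = n \<or> prec m n" using prec_rank_inj[of m n] by (auto simp: prec_iff_rank)
  qed (simp_all add: ns_poly_lead ns_poly_orthogonal prec_iff_rank)
next
  fix p
  assume p: "Poly_Mapping.lookup p n = 1 \<and>
      (\<forall>m\<in>Poly_Mapping.keys p. m = n \<or> prec m n) \<and>
      (\<forall>m. prec m n \<longrightarrow> CT_mu0 (p * X_pow (- m)) = 0)"
  have "p - ns_poly n = 0"
  proof (rule orthogonal_lower_eq_0)
    fix m assume m: "Poly_Mapping.lookup (p - ns_poly n) m \<noteq> 0"
    then have "m \<noteq> n" using p ns_poly_lead[of n] by (auto simp: lookup_minus)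
    moreover have "Poly_Mapping.lookup p m \<noteq> 0 \<or> Poly_Mapping.lookup (ns_poly n) m \<noteq> 0"
      using m by (auto simp: lookup_minus)
    moreover have "prec_rank m < prec_rank n" if "Poly_Mapping.lookup p m \<noteq> 0"
      using p that \<open>m \<noteq> n\<close> by (auto simp: in_keys_iff simp flip: prec_iff_rank)
    moreover have "prec_rank m < prec_rank n" if "Poly_Mapping.lookup (ns_poly n) m \<noteq> 0"
      using ns_poly_support[OF that] \<open>m \<noteq> n\<close> prec_rank_inj[of m n] by linarith
    ultimately show "prec_rank m < prec_rank n" by blast
  next
    fix m assume "prec_rank m < prec_rank n"
    then show "CT_mu0 ((p - ns_poly n) * X_pow (- m)) = 0"
      using p ns_poly_orthogonal[of m n]
      by (simp add: left_diff_distrib CT_mu0_diff prec_iff_rank)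
  qed
  then show "p = ns_poly n" by simp
qed

text \<open>The exponent of \<open>inverse th\<close> is the absolute value of \<open>n\<close> in
  both cases. \<open>L_eval_ns_poly\<close> shows that this is the value at
  \<open>-k/2\<close>.\<close>

definition ns_eval :: "int \<Rightarrow> K" where
  "ns_eval n = (if n > 0 then inverse th ^ nat n else inverse th ^ nat (- n)) * szego_kappa (szego_index n)"

lemma L_eval_ns_poly: "L_eval (ns_poly n) (q_sharp 0) = ns_eval n"
proof -
  have q: "q_sharp 0 = inverse th" by (simp add: q_sharp_def sgn_sharp_def power_int_minus)
  show ?thesis
  proof (cases n rule: int_sign_cases)
    case (pos k)
    moreover have "nat (int k + 1) = Suc k" by simp
    ultimately show ?thesis
      using szego_eval[of k] unfolding q ns_eval_def by (simp only: szego_index_simps) simp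
  next
    case (nonpos k)
    have "L_eval (X_pow 1 * szego_R k) (inverse th) = inverse th * (tK * (inverse th ^ Suc k * szego_kappa k))"
      using szego_eval[of k] by (simp add: L_eval_single_mult)
    then show ?thesis
      using nonpos unfolding q ns_eval_def by (simp add: power2_eq_square)
  qed
qed

lemma ns_eval_ne_0: "ns_eval n \<noteq> 0"
  by (simp add: ns_eval_def szego_kappa_ne_0)

lemma eps_poly_eq: "eps_poly n = L_const (inverse (ns_eval n)) * ns_poly n"
  by (simp add: eps_poly_def e_poly_eq L_eval_ns_poly)

lemma CT_eps: "CT_mu0 (f * eps_poly n) = CT_mu0 (f * ns_poly n) / ns_eval n"
proof -
  have "f * eps_poly n = L_const (inverse (ns_eval n)) * (f * ns_poly n)"
    by (simp only: eps_poly_eq mult.left_commute)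
  then have "CT_mu0 (f * eps_poly n) = inverse (ns_eval n) * CT_mu0 (f * ns_poly n)"
    by (simp only: CT_mu0_scale)
  then show ?thesis by (simp add: divide_inverse)
qed

section \<open>Expansion in the dual basis\<close>

lemma laurent_as_monomials:
  "f = (\<Sum>i\<in>Poly_Mapping.keys f. L_const (Poly_Mapping.lookup f i) * X_pow i)"
  using laurent_sum_single[of f] by (simp add: mult_single)

text \<open>The difference of the two sides is linear in \<open>f\<close> and vanishes on each
  \<open>dual_poly j\<close>, by biorthogonality. These are triangular over the monomials
  \<open>X^-j\<close>, so it vanishes on \<open>f\<close>.\<close>

lemma biorthogonal_expansion:
  assumes "\<And>i. Poly_Mapping.lookup f i \<noteq> 0 \<Longrightarrow> prec_rank (- i) \<le> M"
  shows "CT_mu0 (f * g) = (\<Sum>n | prec_rank n \<le> M.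
     CT_mu0 (f * ns_poly n) * CT_mu0 (g * dual_poly n) / szego_norm (szego_index n))"
proof -
  define \<Phi> where "\<Phi> f = CT_mu0 (f * g) - (\<Sum>n | prec_rank n \<le> M.
     CT_mu0 (f * ns_poly n) * CT_mu0 (g * dual_poly n) / szego_norm (szego_index n))" for f
  have add: "\<Phi> (a + b) = \<Phi> a + \<Phi> b" for a b
    by (simp add: \<Phi>_def distrib_right CT_mu0_add add_divide_distrib sum.distrib)
  have scale: "\<Phi> (L_const c * a) = c * \<Phi> a" for c a
    by (simp add: \<Phi>_def mult.assoc CT_mu0_scale right_diff_distrib sum_distrib_left)
  have zero: "\<Phi> 0 = 0" by (simp add: \<Phi>_def)
  have sum: "\<Phi> (\<Sum>i\<in>A. L_const (c i) * X_pow i) = (\<Sum>i\<in>A. c i * \<Phi> (X_pow i))" for A c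
    by (induction A rule: infinite_finite_induct) (simp_all add: zero add scale)
  have dual: "\<Phi> (dual_poly j) = 0" if "prec_rank j \<le> M" for j
  proof -
    have "(\<Sum>n | prec_rank n \<le> M.
        CT_mu0 (dual_poly j * ns_poly n) * CT_mu0 (g * dual_poly n) / szego_norm (szego_index n)) =
        (\<Sum>n | prec_rank n \<le> M. if n = j then CT_mu0 (g * dual_poly j) else 0)"
      by (rule sum.cong)
         (auto simp: mult.commute[of "dual_poly j"] ns_dual_pairing szego_norm_ne_0)
    then show ?thesis
      using that finite_prec_rank[of M] by (simp add: \<Phi>_def mult.commute)
  qed
  \<comment> \<open>Strong induction on the rank: in \<open>dual_poly j\<close> every monomial other
    than the leading \<open>X^-j\<close> is already known to give zero.\<close>
  have monom: "\<Phi> (X_pow (- j)) = 0" if "prec_rank j \<le> M" for j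
    using that
  proof (induction "prec_rank j" arbitrary: j rule: less_induct)
    case less
    let ?K = "Poly_Mapping.keys (dual_poly j)"
    have j: "- j \<in> ?K" using dual_poly_lead[of j] by (simp add: in_keys_iff)
    have "0 = \<Phi> (dual_poly j)" using dual less.prems by simp
    also have "\<dots> = (\<Sum>i\<in>?K. Poly_Mapping.lookup (dual_poly j) i * \<Phi> (X_pow i))"
      by (subst laurent_as_monomials[of "dual_poly j"]) (rule sum)
    also have "\<dots> = (\<Sum>i\<in>?K. if i = - j then \<Phi> (X_pow (- j)) else 0)"
    proof (rule sum.cong[OF refl])
      fix i assume i: "i \<in> ?K"
      show "Poly_Mapping.lookup (dual_poly j) i * \<Phi> (X_pow i) = (if i = - j then \<Phi> (X_pow (- j)) else 0)"
      proof (cases "i = - j")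
        case False
        then have "prec_rank (- i) \<noteq> prec_rank j" using prec_rank_inj[of "- i" j] by auto
        moreover have "prec_rank (- i) \<le> prec_rank j"
          using i by (intro dual_poly_support) (simp add: in_keys_iff)
        ultimately have "prec_rank (- i) < prec_rank j" by simp
        then show ?thesis using less.hyps[of "- i"] less.prems False by simp
      qed (simp add: dual_poly_lead)
    qed
    also have "\<dots> = \<Phi> (X_pow (- j))" using j by simp
    finally show ?case ..
  qed
  have "\<Phi> f = (\<Sum>i\<in>Poly_Mapping.keys f. Poly_Mapping.lookup f i * \<Phi> (X_pow i))"
    by (subst laurent_as_monomials[of f]) (rule sum)
  also have "\<dots> = 0"
  proof (rule sum.neutral, rule ballI)
    fix i assume "i \<in> Poly_Mapping.keys f"
    then have "prec_rank (- i) \<le> M" by (intro assms) (simp add: in_keys_iff)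
    then show "Poly_Mapping.lookup f i * \<Phi> (X_pow i) = 0" using monom[of "- i"] by simp
  qed
  finally show ?thesis by (simp add: \<Phi>_def)
qed

text \<open>Exponents are negated because \<open>dual_poly n\<close> has leading monomial
  \<open>X^-n\<close>; \<open>insert 0\<close> covers the zero polynomial.\<close>

definition laurent_rank :: "laurent \<Rightarrow> nat" where
  "laurent_rank f = Max (insert 0 ((\<lambda>i. prec_rank (- i)) ` Poly_Mapping.keys f))"

lemma laurent_rank: "Poly_Mapping.lookup f i \<noteq> 0 \<Longrightarrow> prec_rank (- i) \<le> laurent_rank f"
  unfolding laurent_rank_def by (intro Max_ge) (auto simp: in_keys_iff)

text \<open>The source of the finite support that makes \<open>Abs_poly_mapping\<close> meaningful
  in \<open>S_trans\<close>.\<close>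

lemma CT_ns_poly_eq_0:
  assumes "laurent_rank f < prec_rank n"
  shows "CT_mu0 (f * ns_poly n) = 0"
proof -
  have z: "Poly_Mapping.lookup f i * CT_mu0 (ns_poly n * X_pow i) = 0" for i
    using laurent_rank[of f i] ns_poly_orthogonal[of "- i" n] assms by force
  then have "CT_mu0 (ns_poly n * f) = 0" by (subst CT_mu0_mult_keys) (simp only: z sum.neutral_const)
  then show ?thesis by (simp add: mult.commute)
qed

lemma lookup_S_trans: "Poly_Mapping.lookup (S_trans f) n = CT_mu0 (f * eps_poly n)"
proof -
  have "finite {n. CT_mu0 (f * eps_poly n) \<noteq> 0}"
  proof (rule finite_subset[OF _ finite_prec_rank])
    show "{n. CT_mu0 (f * eps_poly n) \<noteq> 0} \<subseteq> {n. prec_rank n \<le> laurent_rank f}"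
      using CT_ns_poly_eq_0[of f] by (auto simp: CT_eps not_le[symmetric])
  qed
  then show ?thesis by (simp add: S_trans_def)
qed

lemma keys_S_trans: "Poly_Mapping.keys (S_trans f) \<subseteq> {n. prec_rank n \<le> laurent_rank f}"
  proof
  fix n assume "n \<in> Poly_Mapping.keys (S_trans f)"
  then have "CT_mu0 (f * ns_poly n) \<noteq> 0" by (simp add: in_keys_iff lookup_S_trans CT_eps)
  then show "n \<in> {n. prec_rank n \<le> laurent_rank f}"
    using CT_ns_poly_eq_0[of f n] by (auto simp: not_le[symmetric])
qed

section \<open>The Plancherel formulas\<close>

text \<open>The scalar relating \<open>t^(-1/2) T\<close> applied to \<open>eps_poly n\<close> to
  \<open>dual_poly n\<close>, as found in \<open>T_op_S_trans\<close>.\<close>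

definition dual_weight :: "int \<Rightarrow> K" where
  "dual_weight n = (if n > 0 then inverse (tK * ns_eval n) else inverse (ns_eval n))"

text \<open>Used with \<open>x = th\<close>, \<open>b = q^(k+1)\<close>, \<open>E\<close> the value
  of \<open>ns_poly\<close> at index \<open>k + 1\<close>, and \<open>p\<close>, \<open>r\<close>
  the pairings of \<open>g\<close> with \<open>szego_P k\<close> and \<open>szego_R k\<close>. The
  contributions of \<open>p\<close> cancel.\<close>

lemma Hecke_step_pos:
  fixes x b p r E :: "'a :: field"
  assumes "x \<noteq> 0" "E \<noteq> 0" "1 - x ^ 2 * b \<noteq> 0" "1 - (x ^ 2) ^ 2 * b \<noteq> 0"
  shows "inverse x * ((x * (x ^ 2 * b) - inverse x) / (x ^ 2 * b - 1) *
      ((r + (1 - x ^ 2) / (1 - x ^ 2 * b) * p) / (E * ((1 - (x ^ 2) ^ 2 * b) / (1 - x ^ 2 * b)))) -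
      (x - inverse x) / (x ^ 2 * b - 1) * (p / E)) = inverse (x ^ 2 * E) * r"
proof -
  define u v where "u = 1 - x ^ 2 * b" and "v = 1 - (x ^ 2) ^ 2 * b"
  have nz: "u \<noteq> 0" "v \<noteq> 0" using assms by (simp_all add: u_def v_def)
  have 1: "x * (x ^ 2 * b) - inverse x = - v / x" and 2: "x ^ 2 * b - 1 = - u"
    and 3: "x - inverse x = (x ^ 2 - 1) / x"
    using assms(1) by (simp_all add: u_def v_def field_simps power2_eq_square)
  show ?thesis
    unfolding 1 2 3 u_def[symmetric] v_def[symmetric]
    using nz assms(1,2) by (simp add: field_simps power2_eq_square)
qed

lemma Hecke_step_neg:
  fixes x b p r E :: "'a :: field"
  assumes "x \<noteq> 0" "E \<noteq> 0" "b \<noteq> 0" "1 - x ^ 2 * b \<noteq> 0" "1 - (x ^ 2) ^ 2 * b \<noteq> 0"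
  shows "inverse x * ((x * inverse (x ^ 2 * b) - inverse x) / (inverse (x ^ 2 * b) - 1) * (p / E) -
      (x - inverse x) / (inverse (x ^ 2 * b) - 1) *
      ((r + (1 - x ^ 2) / (1 - x ^ 2 * b) * p) / (E * ((1 - (x ^ 2) ^ 2 * b) / (1 - x ^ 2 * b))))) =
    inverse (E * ((1 - (x ^ 2) ^ 2 * b) / (1 - x ^ 2 * b))) * (p + b * ((1 - x ^ 2) / (1 - x ^ 2 * b)) * r)"
proof -
  define u v where "u = 1 - x ^ 2 * b" and "v = 1 - (x ^ 2) ^ 2 * b"
  have nz: "u \<noteq> 0" "v \<noteq> 0" using assms by (simp_all add: u_def v_def)
  have 1: "x * inverse (x ^ 2 * b) - inverse x = (1 - b) / (x * b)"
    and 2: "inverse (x ^ 2 * b) - 1 = u / (x ^ 2 * b)"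
    and 3: "x - inverse x = (x ^ 2 - 1) / x"
    using assms(1,3) by (simp_all add: u_def field_simps power2_eq_square)
  \<comment> \<open>The numerator of the coefficient of \<open>p\<close> is a perfect square, so one
    power of \<open>u\<close> cancels.\<close>
  have sq: "(1 - b) * v + b * (1 - x ^ 2) ^ 2 = u ^ 2"
    unfolding u_def v_def by algebra
  have "inverse x * ((1 - b) / (x * b) / (u / (x ^ 2 * b)) * (p / E) -
      (x ^ 2 - 1) / x / (u / (x ^ 2 * b)) * ((r + (1 - x ^ 2) / u * p) / (E * (v / u)))) =
      (((1 - b) * v + b * (1 - x ^ 2) ^ 2) * p / u + b * (1 - x ^ 2) * r) / (E * v)"
    using nz assms(1-3) by (simp add: field_simps power2_eq_square)
  also have "\<dots> = inverse (E * (v / u)) * (p + b * ((1 - x ^ 2) / u) * r)"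
    unfolding sq using nz assms(2) by (simp add: field_simps power2_eq_square)
  finally show ?thesis
    unfolding 1 2 3 u_def[symmetric] v_def[symmetric] .
qed

lemma ns_eval_simps:
  "ns_eval (int k + 1) = inverse th ^ Suc k * szego_kappa k"
  "ns_eval (- int k) = inverse th ^ k * szego_kappa k"
proof -
  have "nat (int k + 1) = Suc k" by simp
  then show "ns_eval (int k + 1) = inverse th ^ Suc k * szego_kappa k"
    unfolding ns_eval_def by (simp only: szego_index_simps) simp
qed (simp add: ns_eval_def)

lemma q_sharp_squared:
  "q_sharp (int k + 1) ^ 2 = th ^ 2 * qK ^ Suc k"
  "q_sharp (- int (Suc k)) ^ 2 = inverse (th ^ 2 * qK ^ Suc k)"
proof -
  have "qh powi (int k + 1) = qh ^ Suc k"
    using power_int_of_nat[of qh "Suc k"] by (simp add: add.commute)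
  then show "q_sharp (int k + 1) ^ 2 = th ^ 2 * qK ^ Suc k"
    by (simp add: q_sharp_def sgn_sharp_def power_mult_distrib mult.commute flip: power_mult)
  have "qh powi (- int (Suc k)) = inverse (qh ^ Suc k)"
    by (simp only: power_int_minus power_int_of_nat)
  then show "q_sharp (- int (Suc k)) ^ 2 = inverse (th ^ 2 * qK ^ Suc k)"
    by (simp add: q_sharp_def sgn_sharp_def power_mult_distrib power_int_minus mult.commute
        power_inverse del: power_Suc flip: power_mult)
qed

text \<open>\<open>T\<close> couples \<open>n\<close> with \<open>-n\<close>, and the polynomials at
  both indices are combinations of the same \<open>szego_P k\<close> and \<open>szego_R k\<close>.
  What remains is a scalar identity in each sign case.\<close>

lemma T_op_S_trans:
  "inverse th * Poly_Mapping.lookup (T_op (S_trans g)) n = dual_weight n * CT_mu0 (g * dual_poly n)"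
proof -
  have T: "Poly_Mapping.lookup (T_op (S_trans g)) n =
      (if n = 0 then 0 else (th * q_sharp n ^ 2 - inverse th) / (q_sharp n ^ 2 - 1) *
        (CT_mu0 (g * ns_poly (- n)) / ns_eval (- n)))
      - (th - inverse th) / (q_sharp n ^ 2 - 1) * (CT_mu0 (g * ns_poly n) / ns_eval n)"
    by (simp add: T_op.rep_eq lookup_S_trans CT_eps)
  have shift: "X_pow 1 * (X_pow (-1) * h) = h" "X_pow (-1) * (X_pow 1 * h) = h" for h :: laurent
    by (simp_all add: mult_single flip: mult.assoc)
  have expand: "CT_mu0 (g * (a + L_const c * b)) = CT_mu0 (g * a) + c * CT_mu0 (g * b)" for a b c
    by (simp add: distrib_left mult.left_commute[of g] CT_mu0_add CT_mu0_scale)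
  \<comment> \<open>The outer power of \<open>X\<close> in the definition cancels the one in the
    recursion, leaving a combination of stage \<open>k\<close>.\<close>
  have rec: "ns_poly (- int (Suc k)) = szego_R k + L_const (szego_coeff (Suc k)) * szego_P k"
    "dual_poly (- int (Suc k)) = szego_P k + L_const (qK ^ Suc k * szego_coeff (Suc k)) * szego_R k" for k
    by (simp_all only: szego_index_simps szego_P.simps szego_R.simps shift)
  have nz: "1 - th ^ 2 * qK ^ Suc k \<noteq> 0" "1 - (th ^ 2) ^ 2 * qK ^ Suc k \<noteq> 0" for k
    using one_minus_tq_ne_0[of "int (Suc k)"] one_minus_t2q_ne_0[of "int (Suc k)"]
    by (simp_all only: power_int_of_nat not_False_eq_True)
  have ev: "ns_eval (- int (Suc k)) =
      ns_eval (int k + 1) * ((1 - (th ^ 2) ^ 2 * qK ^ Suc k) / (1 - th ^ 2 * qK ^ Suc k))" for k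
    unfolding ns_eval_simps by (simp add: szego_kappa_def)
  have nsP: "CT_mu0 (g * ns_poly (- int (Suc k))) =
      CT_mu0 (g * szego_R k) + (1 - th ^ 2) / (1 - th ^ 2 * qK ^ Suc k) * CT_mu0 (g * szego_P k)" for k
    unfolding rec expand szego_coeff_def by (rule refl)
  have duP: "CT_mu0 (g * dual_poly (- int (Suc k))) = CT_mu0 (g * szego_P k) +
      qK ^ Suc k * ((1 - th ^ 2) / (1 - th ^ 2 * qK ^ Suc k)) * CT_mu0 (g * szego_R k)" for k
    unfolding rec expand szego_coeff_def by (rule refl)
  show ?thesis
  proof (cases n rule: int_sign_cases)
    case (pos k)
    have n: "n \<noteq> 0" "- n = - int (Suc k)" using pos by simp_all
    have w: "dual_weight n = inverse (th ^ 2 * ns_eval (int k + 1))"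
      using pos by (simp add: dual_weight_def)
    show ?thesis
      unfolding T if_not_P[OF n(1)] w unfolding n(2) unfolding pos q_sharp_squared(1) szego_index_simps(1,3) nsP ev
      by (rule Hecke_step_pos) (simp_all only: th_nonzero ns_eval_ne_0 nz not_False_eq_True)
  next
    case (nonpos k)
    show ?thesis
    proof (cases k)
      \<comment> \<open>The reflected term is absent here, and the remaining coefficient is
        \<open>th\<close> because \<open>q_sharp 0 = inverse th\<close>.\<close>
      case 0
      have "q_sharp 0 = inverse th" by (simp add: q_sharp_def sgn_sharp_def power_int_minus)
      moreover have "(th - inverse th) / (inverse th ^ 2 - 1) = - th"
        using one_minus_tq_ne_0[of 0] by (simp add: field_simps power2_eq_square)
      moreover have "ns_poly 0 = 1" "dual_poly 0 = 1"
        using szego_index_simps(2,4)[of 0] by (simp_all add: mult_single)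
      ultimately show ?thesis
        using nonpos 0 unfolding T by (simp add: dual_weight_def divide_inverse)
    next
      case (Suc j)
      have n: "n \<noteq> 0" "n = - int (Suc j)" "- n = int j + 1" using nonpos Suc by simp_all
      have w: "dual_weight n = inverse (ns_eval (- int (Suc j)))"
        unfolding n(2) by (simp add: dual_weight_def)
      show ?thesis
        unfolding T if_not_P[OF n(1)] w unfolding n(3)
        unfolding n(2) q_sharp_squared(2) szego_index_simps(1) nsP duP ev
        by (rule Hecke_step_neg) (simp_all only: th_nonzero qh_nonzero power_not_zero ns_eval_ne_0 nz not_False_eq_True)
    qed
  qed
qed

text \<open>The factors \<open>1 - q^i\<close> cancel between \<open>mu1\<close> and the norm,
  leaving \<open>szego_kappa\<close> squared. This and the powers of \<open>t\<close> match the two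
  normalizing values.\<close>

lemma dual_weight_mu1:
  "dual_weight n * mu1 n / ns_eval n = inverse (szego_norm (szego_index n))"
proof -
  let ?A = "\<lambda>i. 1 - tK ^ 2 * qK ^ i" and ?B = "\<lambda>i. 1 - qK ^ i" and ?C = "\<lambda>i. 1 - tK * qK ^ i"
  have B: "?B i \<noteq> 0" if "i \<ge> 1" for i
    using one_minus_q_ne_0[of "int i"] that by simp
  have prods: "(\<Prod>i=1..k. ?A i / ?B i) * (\<Prod>i=1..k. ?B i / ?C i) = szego_kappa k" for k
    unfolding szego_kappa_def prod.distrib[symmetric] by (rule prod.cong) (use B in auto)
  have mu1: "mu1 n = inverse tK ^ szego_index n * (\<Prod>i=1..szego_index n. ?A i / ?B i)"
    by (simp add: mu1_def szego_index_def Let_def)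
  have w: "dual_weight n * inverse tK ^ szego_index n * szego_kappa (szego_index n) ^ 2 = ns_eval n"
  proof (cases n rule: int_sign_cases)
    case (pos k)
    show ?thesis
      unfolding pos dual_weight_def ns_eval_simps szego_index_simps using szego_kappa_ne_0[of k]
      by (simp add: field_simps power2_eq_square power_mult_distrib)
  next
    case (nonpos k)
    show ?thesis
      unfolding nonpos dual_weight_def ns_eval_simps szego_index_simps using szego_kappa_ne_0[of k]
      by (simp add: field_simps power2_eq_square power_mult_distrib)
  qed
  have "dual_weight n * mu1 n * szego_norm (szego_index n) =
      dual_weight n * inverse tK ^ szego_index n * szego_kappa (szego_index n) *
      ((\<Prod>i=1..szego_index n. ?A i / ?B i) * (\<Prod>i=1..szego_index n. ?B i / ?C i))"
    unfolding mu1 szego_norm_def by (simp only: mult_ac)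
  also have "\<dots> = ns_eval n"
    unfolding prods using w by (simp only: power2_eq_square mult_ac)
  finally have "dual_weight n * mu1 n * szego_norm (szego_index n) = ns_eval n" .
  then show ?thesis
    using ns_eval_ne_0[of n] szego_norm_ne_0[of "szego_index n"] by (simp add: field_simps)
qed

text \<open>After the sum over the support is extended to all ranks up to that of \<open>f\<close>,
  it is termwise the biorthogonal expansion.\<close>

lemma Plancherel_S:
  "inverse th * inner1 (S_trans f) (T_op (S_trans g)) = inner0 f g"
proof -
  let ?M = "laurent_rank f"
  have "inverse th * inner1 (S_trans f) (T_op (S_trans g)) =
      (\<Sum>n\<in>Poly_Mapping.keys (S_trans f). Poly_Mapping.lookup (S_trans f) n *
        (inverse th * Poly_Mapping.lookup (T_op (S_trans g)) n) * mu1 n)"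
    unfolding inner1_def sum_distrib_left by (rule sum.cong[OF refl]) (simp only: mult_ac)
  also have "\<dots> = (\<Sum>n | prec_rank n \<le> ?M. Poly_Mapping.lookup (S_trans f) n *
        (inverse th * Poly_Mapping.lookup (T_op (S_trans g)) n) * mu1 n)"
    by (rule sum.mono_neutral_left[OF finite_prec_rank keys_S_trans]) (auto simp: in_keys_iff)
  also have "\<dots> = (\<Sum>n | prec_rank n \<le> ?M.
      CT_mu0 (f * ns_poly n) * CT_mu0 (g * dual_poly n) / szego_norm (szego_index n))"
  proof (rule sum.cong[OF refl])
    fix n
    have "Poly_Mapping.lookup (S_trans f) n *
        (inverse th * Poly_Mapping.lookup (T_op (S_trans g)) n) * mu1 n =
        CT_mu0 (f * ns_poly n) * CT_mu0 (g * dual_poly n) * (dual_weight n * mu1 n / ns_eval n)"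
      unfolding T_op_S_trans lookup_S_trans CT_eps by simp
    then show "Poly_Mapping.lookup (S_trans f) n *
        (inverse th * Poly_Mapping.lookup (T_op (S_trans g)) n) * mu1 n =
        CT_mu0 (f * ns_poly n) * CT_mu0 (g * dual_poly n) / szego_norm (szego_index n)"
      unfolding dual_weight_mu1 by (simp only: divide_inverse)
  qed
  also have "\<dots> = inner0 f g"
    unfolding inner0_def by (rule biorthogonal_expansion[symmetric]) (rule laurent_rank)
  finally show ?thesis .
qed

section \<open>The bar on scalar products and the transform \<open>E\<close>\<close>

lemma K_bar_sum: "K_bar (sum h A) = (\<Sum>a\<in>A. K_bar (h a))"
  by (induction A rule: infinite_finite_induct) (simp_all add: K_bar_hom)

text \<open>\<open>L_bar\<close> reverses exponents, and \<open>K_bar_mu0\<close> reverses the index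
  of the weight in the same way.\<close>

lemma inner0_L_bar: "inner0 (L_bar f) (L_bar g) = K_bar (inner0 f g)"
proof -
  let ?F = "Poly_Mapping.keys f" and ?G = "Poly_Mapping.keys g"
  have "f * g = (\<Sum>m\<in>?F. \<Sum>n\<in>?G.
      Poly_Mapping.single (m + n) (Poly_Mapping.lookup f m * Poly_Mapping.lookup g n))"
    by (subst laurent_sum_single[of f], subst laurent_sum_single[of g])
       (simp only: sum_product mult_single)
  then have "K_bar (inner0 f g) = (\<Sum>m\<in>?F. \<Sum>n\<in>?G.
      K_bar (Poly_Mapping.lookup f m) * K_bar (Poly_Mapping.lookup g n) * mu0 (m + n))"
    by (simp add: inner0_def CT_mu0_sum CT_mu0_single K_bar_sum K_bar_hom K_bar_mu0 add.commute)
  also have "\<dots> = inner0 (L_bar f) (L_bar g)"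
    unfolding inner0_def L_bar_def sum_product mult_single CT_mu0_sum CT_mu0_single by (simp add: add.commute)
  finally show ?thesis ..
qed

theorem theorem7p12:
  fixes f g :: laurent
  shows "inverse th * inner1 (S_trans f) (T_op (S_trans g)) = inner0 f g \<and>
         inverse th * inner1 (E_trans f) (T_op (E_trans g)) = K_bar (inner0 f g)"
proof
  show "inverse th * inner1 (S_trans f) (T_op (S_trans g)) = inner0 f g"
    by (rule Plancherel_S)
  have "E_trans h = S_trans (L_bar h)" for h
    by (simp add: E_trans_def S_trans_def)
  then show "inverse th * inner1 (E_trans f) (T_op (E_trans g)) = K_bar (inner0 f g)"
    by (simp only: Plancherel_S inner0_L_bar)
qed

end
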